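(* Let $\mathbb{F}$ be a field, let $a$ be an odd positive integer and $b$ an even positive integer, $n=a+b$, $\lambda=(a,1^b)$. Then there exists an $\mathscr{H}_n$-endomorphism $f$ of $S_\lambda$ given by $$f(z)=\sum_{\substack{3\leqslant i\leqslant b+1\\ b+3\leqslant j\leqslant n\\ i,j\text{ odd}}}\frac{i-1}{2}\cdot\frac{n+2-j}{2}\,v_{T_{i,j}}.$$
   Context: The algebra. $\mathscr{H}_n=\mathscr{H}_{\mathbb{F},-1}(\mathfrak{S}_n)$ is the Iwahori--Hecke algebra at $q=-1$ over a field $\mathbb{F}$, identified via the Brundan--Kleshchev isomorphism with the unital associative $\mathbb{F}$-algebra with generators $y_1,\dots,y_n$, $\psi_1,\dots,\psi_{n-1}$, $e(i)$ ($i=(i_1,\dots,i_n)\in\{0,1\}^n$) and relations: $y_1=0$; $e(i)=0$ if $i_1=1$; $e(i)e(j)=\delta_{ij}e(i)$; $\sum_i e(i)=1$; $y_re(i)=e(i)y_r$; $\psi_re(i)=e(s_r\cdot i)\psi_r$, where $s_r\cdot i$ swaps the $r$-th and $(r+1)$-th terms of $i$; $y_sy_r=y_ry_s$; $y_s\psi_r=\psi_ry_s$ if $s\neq r,r+1$; $y_r\psi_re(i)=(\psi_ry_{r+1}-\delta_{i_r,i_{r+1}})e(i)$; $y_{r+1}\psi_re(i)=(\psi_ry_r+\delta_{i_r,i_{r+1}})e(i)$; $\psi_s\psi_r=\psi_r\psi_s$ if $s\neq r\pm1$; $\psi_r^2e(i)=0$ if $i_r=i_{r+1}$ and $\psi_r^2e(i)=-(y_r-y_{r+1})^2e(i)$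 if $i_r\neq i_{r+1}$; $\psi_r\psi_{r+1}\psi_re(i)=\psi_{r+1}\psi_r\psi_{r+1}e(i)$ if $i_r=i_{r+1}$ or $i_{r+1}=i_{r+2}$; $\psi_r\psi_{r+1}\psi_re(i)=(\psi_{r+1}\psi_r\psi_{r+1}+y_r-2y_{r+1}+y_{r+2})e(i)$ if $i_r\neq i_{r+1}\neq i_{r+2}$. The Specht module. For $\lambda=(a,1^b)$, $n=a+b$, the node in row $r$ and column $c$ has residue $c-r\pmod 2$; $T_\lambda$ is the tableau with $1,\dots,n$ entered consecutively down the columns; $i_\lambda\in\{0,1\}^n$ has $k$-th term the residue of the node containing $k$ in $T_\lambda$. $S_\lambda$ is the left $\mathscr{H}_n$-module generated by $z$ subject to: $y_kz=0$ for all $k$; $e(i)z=\delta_{i,i_\lambda}z$ for all $i$; $\psi_jz=0$ for all $j\neq b+1$; $\psi_1\psi_2\cdots\psi_{b+1}z=0$ (the last relation omitted when $a=1$). Tableaux and the basis. For a standard $\lambda$-tableau $T$ (entries $1,\dots,n$, increasing along rows and down columns), $w_T\in\mathfrak{S}_n$ is defined by $w_TT_\lambda=T$ ($w_T$ acting on entries), and $v_T=\psi_{r_1}\cdots\psi_{r_m}z$ for a reduced expression $w_T=s_{r_1}\cdots s_{r_m}$, $s_r=(r,r+1)$; for hooks this is independent of the reduced expression, and the $v_T$ form a basis of $S_\lambda$. The leg of $\lambda$ is the set of nodes $\{(2,1),\dots,(b+1,1)\}$ and the arm is $\{(1,2),\dots,(1,a)\}$. The tableaux $T_{i,j}$. For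 odd $i,j$ with $3\leqslant i\leqslant b+1<j\leqslant n$, $T_{i,j}$ is the standard $\lambda$-tableau whose leg entries are $\bigl(\{2,3,\dots,b+1\}\setminus\{i-1,i\}\bigr)\cup\{j-1,j\}$. *)

theory Defs
  imports
    "HOL-Algebra.QuotRing"
    "HOL-Algebra.Module"
    "HOL-Library.Poly_Mapping"
    "HOL-Library.FuncSet"
    "HOL-Combinatorics.Permutations"
begin

section \<open>Free associative algebras\<close>

text \<open>A separate type, rather than an instance of \<^class>\<open>monoid_add\<close> for lists,
  so that no class instance for lists is imposed on importing theories.\<close>

datatype 'x free_monoid = Word (letters: "'x list")

instantiation free_monoid :: (type) monoid_add
begin

definition zero_free_monoid :: "'a free_monoid" where
  "0 = Word []"

definition plus_free_monoid :: "'a free_monoid \<Rightarrow> 'a free_monoid \<Rightarrow> 'a free_monoid" where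
  "u + v = Word (letters u @ letters v)"

instance
  by standard (simp_all add: zero_free_monoid_def plus_free_monoid_def)

end

text \<open>The multiplication of \<^type>\<open>poly_mapping\<close> over this index monoid is the
  concatenation product, so the full type is the free algebra on all of \<^typ>\<open>'x\<close>.\<close>

definition free_algebra :: "'x set \<Rightarrow> ('x free_monoid \<Rightarrow>\<^sub>0 'a::field) ring" where
  "free_algebra G =
     \<lparr>carrier = {p. Poly_Mapping.keys p \<subseteq> Word ` lists G},
      monoid.mult = (*), one = 1, zero = 0, add = (+)\<rparr>"

lemma ring_free_algebra: "ring (free_algebra G :: ('x free_monoid \<Rightarrow>\<^sub>0 'a::field) ring)"
proof -
  let ?W = "Word ` lists G"
  have plus: "Poly_Mapping.keys (p + q) \<subseteq> ?W"
    if "Poly_Mapping.keys p \<subseteq> ?W" "Poly_Mapping.keys q \<subseteq> ?W"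
    for p q :: "'x free_monoid \<Rightarrow>\<^sub>0 'a"
    using that Poly_Mapping.keys_add[of p q] by blast
  have times: "Poly_Mapping.keys (p * q) \<subseteq> ?W"
    if "Poly_Mapping.keys p \<subseteq> ?W" "Poly_Mapping.keys q \<subseteq> ?W"
    for p q :: "'x free_monoid \<Rightarrow>\<^sub>0 'a"
  proof
    fix u assume "u \<in> Poly_Mapping.keys (p * q)"
    then obtain v w where "u = v + w" "v \<in> Poly_Mapping.keys p" "w \<in> Poly_Mapping.keys q"
      using keys_mult[of p q] by blast
    with that obtain vs ws where "u = Word vs + Word ws" "vs \<in> lists G" "ws \<in> lists G"
      by blast
    then show "u \<in> ?W" by (auto simp: plus_free_monoid_def)
  qed
  have neg: "\<exists>q. Poly_Mapping.keys q \<subseteq> ?W \<and> q + p = 0"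
    if "Poly_Mapping.keys p \<subseteq> ?W" for p :: "'x free_monoid \<Rightarrow>\<^sub>0 'a"
    using that by (intro exI[of _ "- p"]) simp
  let ?F = "free_algebra G :: ('x free_monoid \<Rightarrow>\<^sub>0 'a) ring"
  have one: "Poly_Mapping.keys (1 :: 'x free_monoid \<Rightarrow>\<^sub>0 'a) \<subseteq> ?W"
    by (auto simp: zero_free_monoid_def)
  show ?thesis
  proof (rule ringI)
    show "abelian_group ?F"
      by (rule abelian_groupI) (use plus neg in \<open>simp_all add: free_algebra_def algebra_simps\<close>)
    show "Group.monoid ?F"
      by (rule monoidI) (use times one in \<open>simp_all add: free_algebra_def algebra_simps\<close>)
  qed (simp_all add: free_algebra_def algebra_simps)
qed


section \<open>Left ideals and left modules\<close>

text \<open>In HOL-Algebra ideals are two-sided and the scalars of a module are commutative.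
  The record \<^type>\<open>module\<close> is reused for left modules over arbitrary rings.\<close>

definition left_ideal :: "('a, 'm) ring_scheme \<Rightarrow> 'a set \<Rightarrow> bool" where
  "left_ideal R J \<longleftrightarrow>
     additive_subgroup J R \<and> (\<forall>r\<in>carrier R. \<forall>x\<in>J. r \<otimes>\<^bsub>R\<^esub> x \<in> J)"

definition left_ideal_gen :: "('a, 'm) ring_scheme \<Rightarrow> 'a set \<Rightarrow> 'a set" where
  "left_ideal_gen R S = \<Inter>{J. left_ideal R J \<and> S \<subseteq> J}"

text \<open>The quotient of the regular left module by a left ideal. The ring multiplication
  fields of the record have no meaning for modules.\<close>

definition left_quotient :: "('a, 'm) ring_scheme \<Rightarrow> 'a set \<Rightarrow> ('a, 'a set) module" where
  "left_quotient R J =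
     \<lparr>carrier = a_rcosets\<^bsub>R\<^esub> J, monoid.mult = undefined, one = undefined,
      zero = J, add = set_add R,
      smult = (\<lambda>r A. \<Union>x\<in>A. J +>\<^bsub>R\<^esub> (r \<otimes>\<^bsub>R\<^esub> x))\<rparr>"

definition left_module_hom ::
    "('r, 'm) ring_scheme \<Rightarrow> ('r, 'a, 'k) module_scheme \<Rightarrow> ('r, 'b, 'l) module_scheme
      \<Rightarrow> ('a \<Rightarrow> 'b) set" where
  "left_module_hom R M N =
     {f \<in> carrier M \<rightarrow> carrier N.
        (\<forall>x\<in>carrier M. \<forall>y\<in>carrier M. f (x \<oplus>\<^bsub>M\<^esub> y) = f x \<oplus>\<^bsub>N\<^esub> f y) \<and>
        (\<forall>r\<in>carrier R. \<forall>x\<in>carrier M. f (r \<odot>\<^bsub>M\<^esub> x) = r \<odot>\<^bsub>N\<^esub> f x)}"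


section \<open>The Hecke algebra at $q=-1$\<close>

text \<open>The Iwahori--Hecke algebra of the symmetric group is taken in its presentation
  coming from the Brundan--Kleshchev isomorphism.\<close>

text \<open>The set $\{0,1\}^n$, with entries indexed from 1.\<close>

definition residue_seqs :: "nat \<Rightarrow> (nat \<Rightarrow> int) set" where
  "residue_seqs n = {1..n} \<rightarrow>\<^sub>E {0, 1}"

definition swap_seq :: "nat \<Rightarrow> (nat \<Rightarrow> int) \<Rightarrow> (nat \<Rightarrow> int)" where
  "swap_seq r i = i \<circ> transpose r (Suc r)"

datatype klr_gen = GenY nat | GenPsi nat | GenE "nat \<Rightarrow> int"

definition klr_gens :: "nat \<Rightarrow> klr_gen set" where
  "klr_gens n = GenY ` {1..n} \<union> GenPsi ` {1..<n} \<union> GenE ` residue_seqs n"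

type_synonym 'a klr_free = "klr_gen free_monoid \<Rightarrow>\<^sub>0 'a"

definition free_y :: "nat \<Rightarrow> 'a::field klr_free" where
  "free_y r = Poly_Mapping.single (Word [GenY r]) 1"

definition free_psi :: "nat \<Rightarrow> 'a::field klr_free" where
  "free_psi r = Poly_Mapping.single (Word [GenPsi r]) 1"

definition free_e :: "(nat \<Rightarrow> int) \<Rightarrow> 'a::field klr_free" where
  "free_e i = Poly_Mapping.single (Word [GenE i]) 1"

text \<open>Each relation $l = r$ is recorded as the element $l - r$ of the free algebra.\<close>

definition klr_relations :: "nat \<Rightarrow> 'a::field klr_free set" where
  "klr_relations n =
     (let I = residue_seqs n; y = free_y; \<psi> = free_psi; e = free_e in
      {y 1} \<union>
      {e i | i. i \<in> I \<and> i 1 = 1} \<union>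
      {e i * e j - (if i = j then e i else 0) | i j. i \<in> I \<and> j \<in> I} \<union>
      {(\<Sum>i\<in>I. e i) - 1} \<union>
      {y r * e i - e i * y r | r i. r \<in> {1..n} \<and> i \<in> I} \<union>
      {\<psi> r * e i - e (swap_seq r i) * \<psi> r | r i. r \<in> {1..<n} \<and> i \<in> I} \<union>
      {y s * y r - y r * y s | r s. r \<in> {1..n} \<and> s \<in> {1..n}} \<union>
      {y s * \<psi> r - \<psi> r * y s | r s.
         r \<in> {1..<n} \<and> s \<in> {1..n} \<and> s \<noteq> r \<and> s \<noteq> r + 1} \<union>
      {y r * \<psi> r * e i - (\<psi> r * y (r + 1) - (if i r = i (r + 1) then 1 else 0)) * e i | r i.
         r \<in> {1..<n} \<and> i \<in> I} \<union>
      {y (r + 1) * \<psi> r * e i - (\<psi> r * y r + (if i r = i (r + 1) then 1 else 0)) * e i | r i.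
         r \<in> {1..<n} \<and> i \<in> I} \<union>
      {\<psi> s * \<psi> r - \<psi> r * \<psi> s | r s.
         r \<in> {1..<n} \<and> s \<in> {1..<n} \<and> s \<noteq> r + 1 \<and> r \<noteq> s + 1} \<union>
      {(\<psi> r)^2 * e i | r i. r \<in> {1..<n} \<and> i \<in> I \<and> i r = i (r + 1)} \<union>
      {(\<psi> r)^2 * e i - (- ((y r - y (r + 1))^2 * e i)) | r i.
         r \<in> {1..<n} \<and> i \<in> I \<and> i r \<noteq> i (r + 1)} \<union>
      {\<psi> r * \<psi> (r + 1) * \<psi> r * e i - \<psi> (r + 1) * \<psi> r * \<psi> (r + 1) * e i | r i.
         1 \<le> r \<and> r + 2 \<le> n \<and> i \<in> I \<and> (i r = i (r + 1) \<or> i (r + 1) = i (r + 2))} \<union>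
      {\<psi> r * \<psi> (r + 1) * \<psi> r * e i -
         (\<psi> (r + 1) * \<psi> r * \<psi> (r + 1) + y r - 2 * y (r + 1) + y (r + 2)) * e i | r i.
         1 \<le> r \<and> r + 2 \<le> n \<and> i \<in> I \<and> i r \<noteq> i (r + 1) \<and> i (r + 1) \<noteq> i (r + 2)})"

type_synonym 'a hecke = "'a klr_free set"

definition hecke_ideal :: "nat \<Rightarrow> 'a::field klr_free set" where
  "hecke_ideal n = genideal (free_algebra (klr_gens n)) (klr_relations n)"

definition hecke_algebra :: "nat \<Rightarrow> 'a::field hecke ring" where
  "hecke_algebra n = free_algebra (klr_gens n) Quot hecke_ideal n"

definition hecke_class :: "nat \<Rightarrow> 'a::field klr_free \<Rightarrow> 'a hecke" where
  "hecke_class n p = hecke_ideal n +>\<^bsub>free_algebra (klr_gens n)\<^esub> p"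

definition hecke_y :: "nat \<Rightarrow> nat \<Rightarrow> 'a::field hecke" where
  "hecke_y n r = hecke_class n (free_y r)"

definition hecke_psi :: "nat \<Rightarrow> nat \<Rightarrow> 'a::field hecke" where
  "hecke_psi n r = hecke_class n (free_psi r)"

definition hecke_e :: "nat \<Rightarrow> (nat \<Rightarrow> int) \<Rightarrow> 'a::field hecke" where
  "hecke_e n i = hecke_class n (free_e i)"

text \<open>The structure map of the algebra, sending $c \in \mathbb{F}$ to $c \cdot 1$. As its
  image lies in the algebra, homomorphisms of left modules are linear over the field.\<close>

definition hecke_scalar :: "nat \<Rightarrow> 'a::field \<Rightarrow> 'a hecke" where
  "hecke_scalar n c = hecke_class n (Poly_Mapping.single 0 c)"


section \<open>Hook tableaux\<close>

text \<open>Nodes of $(a,1^b)$ are pairs (row, column), counted from 1. Tableaux are functions on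
  nodes, extensional so that they are determined by their entries.\<close>

definition hook_arm :: "nat \<Rightarrow> (nat \<times> nat) set" where
  "hook_arm a = {(1, c) | c. 2 \<le> c \<and> c \<le> a}"

definition hook_leg :: "nat \<Rightarrow> (nat \<times> nat) set" where
  "hook_leg b = {(r, 1) | r. 2 \<le> r \<and> r \<le> b + 1}"

definition hook :: "nat \<Rightarrow> nat \<Rightarrow> (nat \<times> nat) set" where
  "hook a b = {(1, 1)} \<union> hook_arm a \<union> hook_leg b"

definition residue :: "nat \<times> nat \<Rightarrow> int" where
  "residue = (\<lambda>(r, c). (int c - int r) mod 2)"

definition tableau :: "nat \<Rightarrow> nat \<Rightarrow> (nat \<times> nat \<Rightarrow> nat) \<Rightarrow> bool" where
  "tableau a b T \<longleftrightarrow> T \<in> extensional (hook a b) \<and> bij_betw T (hook a b) {1..a + b}"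

definition standard_tableau :: "nat \<Rightarrow> nat \<Rightarrow> (nat \<times> nat \<Rightarrow> nat) \<Rightarrow> bool" where
  "standard_tableau a b T \<longleftrightarrow> tableau a b T \<and>
     (\<forall>r c c'. (r, c) \<in> hook a b \<longrightarrow> (r, c') \<in> hook a b \<longrightarrow> c < c' \<longrightarrow> T (r, c) < T (r, c')) \<and>
     (\<forall>r r' c. (r, c) \<in> hook a b \<longrightarrow> (r', c) \<in> hook a b \<longrightarrow> r < r' \<longrightarrow> T (r, c) < T (r', c))"

text \<open>Entries run down the first column, which has $b+1$ nodes, and then along the
  remaining columns, which have one node each.\<close>

definition initial_tableau :: "nat \<Rightarrow> nat \<Rightarrow> nat \<times> nat \<Rightarrow> nat" where
  "initial_tableau a b = (\<lambda>(r, c)\<in>hook a b. if c = 1 then r else b + c)"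

definition initial_residues :: "nat \<Rightarrow> nat \<Rightarrow> nat \<Rightarrow> int" where
  "initial_residues a b =
     (\<lambda>k\<in>{1..a + b}. residue (the_inv_into (hook a b) (initial_tableau a b) k))"

definition tableau_perm :: "nat \<Rightarrow> nat \<Rightarrow> (nat \<times> nat \<Rightarrow> nat) \<Rightarrow> nat \<Rightarrow> nat" where
  "tableau_perm a b T =
     (THE w. w permutes {1..a + b} \<and> (\<forall>x\<in>hook a b. w (initial_tableau a b x) = T x))"

definition word_perm :: "nat list \<Rightarrow> nat \<Rightarrow> nat" where
  "word_perm rs = foldr (\<lambda>r w. transpose r (Suc r) \<circ> w) rs id"

definition reduced_expression :: "nat \<Rightarrow> (nat \<Rightarrow> nat) \<Rightarrow> nat list \<Rightarrow> bool" where
  "reduced_expression n w rs \<longleftrightarrow>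
     rs \<in> lists {1..<n} \<and> word_perm rs = w \<and>
     (\<forall>rs'\<in>lists {1..<n}. word_perm rs' = w \<longrightarrow> length rs \<le> length rs')"

definition T_tableau :: "nat \<Rightarrow> nat \<Rightarrow> nat \<Rightarrow> nat \<Rightarrow> nat \<times> nat \<Rightarrow> nat" where
  "T_tableau a b i j =
     (THE T. standard_tableau a b T \<and>
        T ` hook_leg b = ({2..b + 1} - {i - 1, i}) \<union> {j - 1, j})"


section \<open>Specht modules of hooks\<close>

type_synonym 'a specht = "'a hecke set"

definition specht_relations :: "nat \<Rightarrow> nat \<Rightarrow> 'a::field hecke set" where
  "specht_relations a b =
     (let n = a + b; H = hecke_algebra n in
      {hecke_y n k | k. k \<in> {1..n}} \<union>
      {hecke_e n i \<ominus>\<^bsub>H\<^esub> (if i = initial_residues a b then \<one>\<^bsub>H\<^esub> else \<zero>\<^bsub>H\<^esub>) | i.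
         i \<in> residue_seqs n} \<union>
      {hecke_psi n j | j. j \<in> {1..<n} \<and> j \<noteq> b + 1} \<union>
      (if a = 1 then {}
       else {foldr (\<lambda>r h. hecke_psi n r \<otimes>\<^bsub>H\<^esub> h) [1..<b + 2] \<one>\<^bsub>H\<^esub>}))"

definition specht_ideal :: "nat \<Rightarrow> nat \<Rightarrow> 'a::field hecke set" where
  "specht_ideal a b = left_ideal_gen (hecke_algebra (a + b)) (specht_relations a b)"

definition specht :: "nat \<Rightarrow> nat \<Rightarrow> ('a::field hecke, 'a specht) module" where
  "specht a b = left_quotient (hecke_algebra (a + b)) (specht_ideal a b)"

definition specht_z :: "nat \<Rightarrow> nat \<Rightarrow> 'a::field specht" where
  "specht_z a b =
     specht_ideal a b +>\<^bsub>hecke_algebra (a + b)\<^esub> \<one>\<^bsub>hecke_algebra (a + b)\<^esub>"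

text \<open>For hooks the result does not depend on the chosen reduced expression.\<close>

definition specht_v :: "nat \<Rightarrow> nat \<Rightarrow> (nat \<times> nat \<Rightarrow> nat) \<Rightarrow> 'a::field specht" where
  "specht_v a b T =
     foldr (\<lambda>r v. hecke_psi (a + b) r \<odot>\<^bsub>specht a b\<^esub> v)
       (SOME rs. reduced_expression (a + b) (tableau_perm a b T) rs)
       (specht_z a b)"

end

(*
The terms after the first one in the residue sequence 0,1,0,1,... of T_lambda are grouped into dominoes: the
k-th domino consists of the places 2k and 2k+1. Let G be the space of the vectors of this residue sequence
that are killed by all y_r and by all psi_r with r even. Put phi_k = psi_(2k+1), and let
Psi_k = psi_(2k+1) psi_(2k) psi_(2k+2) psi_(2k+1), which exchanges the dominoes k and k+1. Then Psi_k maps G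
to itself, and on G there are relations of Temperley-Lieb type: phi_k Psi_k = -2 phi_k, and
phi_k Psi_l Psi_k x = phi_k x for l = k-1 and l = k+1 if phi_l x = 0. The generator z lies in G. With b = 2m
and n = 2N+1, the vector v_T for T = T_{2p+1,2q+1} is Psi_p ... Psi_(m-1) Psi_(q-1) ... Psi_m z. By the
relations, phi_k f(z) is governed by the second differences in p (for k < m) or in q (for k > m) of the
coefficients p (N+1-q), hence it is 0. The remaining relations, for psi_1 f(z) and
psi_1 ... psi_(b+1) f(z), hold because these vectors have residue sequences that start with 1.
*)
theory Submission
  imports Defs "HOL.Vector_Spaces"
begin

section \<open>Vectors of alternating residue sequence\<close>

text \<open>The factors p and N+1-q vanish at p = 0 and at q = N+1. So the second differences vanish
  at the ends of the ranges as well, where one of the three neighbouring vectors is missing. There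
  is no condition for k = m, since psi_(b+1) z is not among the relations; hence the two factors can
  be treated separately. All identities involve only integer multiples, so the characteristic of the
  field does not matter. Two gaps lie between this computation and the statement. First, v_T is
  formed with an unknown reduced word. The permutations are Grassmannian: their reduced words raise
  the set of first column entries by one unit per letter, and two such words with the same result
  differ by exchanges of commuting letters. Secondly, elements of the module are cosets of cosets.
  The computation takes place instead in a linear complement of the kernel of the map from the free
  algebra onto the module. There f is induced by right multiplication with a lift of f(z), which is
  well defined once every relation sends the lift into the kernel.\<close>

definition alt_seq :: "nat \<Rightarrow> nat \<Rightarrow> int" where
  "alt_seq n = (\<lambda>k\<in>{1..n}. if even k then 1 else 0)"

text \<open>\<open>W i\<close>, \<open>Y r\<close> and \<open>P r\<close> stand for the weight space $e(i)M$ of a module $M$ and for the actions of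
  $y_r$ and $\psi_r$ on $M$. Of the ring structure of \<open>'m\<close> only the multiplication by integers is used.\<close>

locale klr_action =
  fixes n :: nat
    and W :: "(nat \<Rightarrow> int) \<Rightarrow> 'm::ring_1 set"
    and Y P :: "nat \<Rightarrow> 'm \<Rightarrow> 'm"
  assumes W_zero: "0 \<in> W (alt_seq n)"
    and W_add: "x \<in> W i \<Longrightarrow> y \<in> W i \<Longrightarrow> x + y \<in> W i"
    and Y_add: "Y r (x + y) = Y r x + Y r y"
    and P_add: "P r (x + y) = P r x + P r y"
    and YW: "x \<in> W i \<Longrightarrow> r \<in> {1..n} \<Longrightarrow> Y r x \<in> W i"
    and PW: "x \<in> W i \<Longrightarrow> r \<in> {1..<n} \<Longrightarrow> P r x \<in> W (swap_seq r i)"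
    and W_first: "x \<in> W i \<Longrightarrow> i 1 = 1 \<Longrightarrow> x = 0"
    and YP_far: "x \<in> W i \<Longrightarrow> r \<in> {1..<n} \<Longrightarrow> s \<in> {1..n} \<Longrightarrow> s \<noteq> r \<Longrightarrow> s \<noteq> r + 1 \<Longrightarrow>
      Y s (P r x) = P r (Y s x)"
    and YP_left: "x \<in> W i \<Longrightarrow> r \<in> {1..<n} \<Longrightarrow>
      Y r (P r x) = P r (Y (r + 1) x) - (if i r = i (r + 1) then x else 0)"
    and YP_right: "x \<in> W i \<Longrightarrow> r \<in> {1..<n} \<Longrightarrow>
      Y (r + 1) (P r x) = P r (Y r x) + (if i r = i (r + 1) then x else 0)"
    and PP_far: "x \<in> W i \<Longrightarrow> r \<in> {1..<n} \<Longrightarrow> s \<in> {1..<n} \<Longrightarrow> s \<noteq> r + 1 \<Longrightarrow> r \<noteq> s + 1 \<Longrightarrow>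
      P s (P r x) = P r (P s x)"
    and PP_diff: "x \<in> W i \<Longrightarrow> r \<in> {1..<n} \<Longrightarrow> i r \<noteq> i (r + 1) \<Longrightarrow>
      P r (P r x) = - (Y r (Y r x) - Y r (Y (r + 1) x) - Y (r + 1) (Y r x) + Y (r + 1) (Y (r + 1) x))"
    and braid: "x \<in> W i \<Longrightarrow> 1 \<le> r \<Longrightarrow> r + 2 \<le> n \<Longrightarrow> i r = i (r + 1) \<or> i (r + 1) = i (r + 2) \<Longrightarrow>
      P r (P (r + 1) (P r x)) = P (r + 1) (P r (P (r + 1) x))"
    and braid_alt: "x \<in> W i \<Longrightarrow> 1 \<le> r \<Longrightarrow> r + 2 \<le> n \<Longrightarrow> i r \<noteq> i (r + 1) \<Longrightarrow> i (r + 1) \<noteq> i (r + 2) \<Longrightarrow>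
      P r (P (r + 1) (P r x)) = P (r + 1) (P r (P (r + 1) x)) + Y r x - 2 * Y (r + 1) x + Y (r + 2) x"
begin

lemma P_zero [simp]: "P r 0 = 0" and Y_zero [simp]: "Y r 0 = 0"
  using P_add[of r 0 0] Y_add[of r 0 0] by simp_all

lemma P_minus [simp]: "P r (- x) = - P r x" and Y_minus [simp]: "Y r (- x) = - Y r x"
  using P_add[of r x "- x"] Y_add[of r x "- x"] by (simp_all add: eq_neg_iff_add_eq_0 add.commute)

end

lemma swap_seq_equal: "i r = i (Suc r) \<Longrightarrow> swap_seq r i = i"
  by (auto simp: swap_seq_def fun_eq_iff transpose_def)

lemma swap_seq_involutory [simp]: "swap_seq r (swap_seq r i) = i"
  by (simp add: swap_seq_def comp_assoc)

section \<open>Exchange of two neighbouring dominoes\<close>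

context klr_action
begin

definition good :: "'m set" where
  "good = {x \<in> W (alt_seq n). (\<forall>r\<in>{1..n}. Y r x = 0) \<and> (\<forall>r\<in>{1..<n}. even r \<longrightarrow> P r x = 0)}"

text \<open>The index is the first place of the left domino, so Psi_k is
  \<open>dswap (2 * k)\<close>; likewise phi_k is \<open>P (r + 1)\<close> for
  \<open>r = 2 * k\<close>.\<close>

definition dswap :: "nat \<Rightarrow> 'm \<Rightarrow> 'm" where
  "dswap r x = P (r + 1) (P r (P (r + 2) (P (r + 1) x)))"

context
  fixes r x
  assumes r: "even r" "0 < r" "r + 3 \<le> n" and x: "x \<in> good"
begin

lemma alt_seq_values: "alt_seq n r = 1" "alt_seq n (r + 1) = 0" "alt_seq n (r + 2) = 1" "alt_seq n (r + 3) = 0"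
  using r by (auto simp: alt_seq_def)

text \<open>The window 1,0,1,0 becomes 1,1,0,0. Now psi_r and psi_(r+2) act between equal residues:
  they fix the sequence, and the y_s acquire correction terms in passing them.\<close>

lemma swapped_values: "swap_seq (r + 1) (alt_seq n) r = 1" "swap_seq (r + 1) (alt_seq n) (r + 1) = 1" "swap_seq (r + 1) (alt_seq n) (r + 2) = 0" "swap_seq (r + 1) (alt_seq n) (r + 3) = 0"
  using r by (auto simp: alt_seq_def swap_seq_def transpose_def)

lemma goodD: "x \<in> W (alt_seq n)" "\<And>s. s \<in> {1..n} \<Longrightarrow> Y s x = 0"
    "\<And>s. s \<in> {1..<n} \<Longrightarrow> even s \<Longrightarrow> P s x = 0"
  using x by (auto simp: good_def)

lemma W_swap: "P (r + 1) x \<in> W (swap_seq (r + 1) (alt_seq n))"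
  using PW[OF goodD(1), of "r + 1"] r by simp

text \<open>The residues at \<open>r + 1\<close> and \<open>r + 2\<close> differ, so every y passes
  psi_(r+1) without correction and reaches \<open>x\<close>.\<close>

lemma Y_swap: "s \<in> {1..n} \<Longrightarrow> Y s (P (r + 1) x) = 0"
  using YP_left[OF goodD(1), of "r + 1"] YP_right[OF goodD(1), of "r + 1"]
    YP_far[OF goodD(1), of "r + 1" s] r goodD(2) alt_seq_values
  by (cases "s = r + 1"; cases "s = r + 2") (auto simp: numeral_eq_Suc)

lemma W_swap_left: "P r (P (r + 1) x) \<in> W (swap_seq (r + 1) (alt_seq n))"
  using PW[OF W_swap, of r] swap_seq_equal[of "swap_seq (r + 1) (alt_seq n)" r] swapped_values r by simp

lemma W_swap_right: "P (r + 2) (P (r + 1) x) \<in> W (swap_seq (r + 1) (alt_seq n))"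
  using PW[OF W_swap, of "r + 2"] swap_seq_equal[of "swap_seq (r + 1) (alt_seq n)" "r + 2"] swapped_values r by (simp add: numeral_eq_Suc)

lemma W_swap_both: "P r (P (r + 2) (P (r + 1) x)) \<in> W (swap_seq (r + 1) (alt_seq n))"
  using PW[OF W_swap_right, of r] swap_seq_equal[of "swap_seq (r + 1) (alt_seq n)" r] swapped_values r by simp

lemma swap_left_right_commute: "P (r + 2) (P r (P (r + 1) x)) = P r (P (r + 2) (P (r + 1) x))"
  using PP_far[OF W_swap, of r "r + 2"] r by simp

text \<open>In the alternating braid relations at \<open>r\<close> and \<open>r + 1\<close> the
  other product contains psi_r x or psi_(r+2) x, which are 0, and the correction terms y x are 0
  too.\<close>

lemma swap_braid_zero: "P (r + 1) (P r (P (r + 1) x)) = 0" "P (r + 1) (P (r + 2) (P (r + 1) x)) = 0"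
proof -
  have "P r x = 0" "P (r + 2) x = 0" using goodD(3) r by simp_all
  then show "P (r + 1) (P r (P (r + 1) x)) = 0" "P (r + 1) (P (r + 2) (P (r + 1) x)) = 0"
    using braid_alt[OF goodD(1), of r] braid_alt[OF goodD(1), of "r + 1"] alt_seq_values r goodD(2)
    by (simp_all add: numeral_eq_Suc)
qed

lemma Y_swap_left: "s \<in> {1..n} \<Longrightarrow> Y s (P r (P (r + 1) x)) =
    (if s = r then - P (r + 1) x else if s = r + 1 then P (r + 1) x else 0)"
  using YP_left[OF W_swap, of r] YP_right[OF W_swap, of r] YP_far[OF W_swap, of r s] r Y_swap swapped_values
  by auto

lemma Y_swap_right: "s \<in> {1..n} \<Longrightarrow> Y s (P (r + 2) (P (r + 1) x)) =
    (if s = r + 2 then - P (r + 1) x else if s = r + 3 then P (r + 1) x else 0)"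
  using YP_left[OF W_swap, of "r + 2"] YP_right[OF W_swap, of "r + 2"] YP_far[OF W_swap, of "r + 2" s] r Y_swap swapped_values
  by (auto simp: numeral_eq_Suc)

lemma Y_swap_both: "s \<in> {1..n} \<Longrightarrow> Y s (P r (P (r + 2) (P (r + 1) x))) =
    (if s = r then - P (r + 2) (P (r + 1) x) else if s = r + 1 then P (r + 2) (P (r + 1) x)
     else if s = r + 2 then - P r (P (r + 1) x) else if s = r + 3 then P r (P (r + 1) x) else 0)"
  using YP_left[OF W_swap_right, of r] YP_right[OF W_swap_right, of r] YP_far[OF W_swap_right, of r s] r Y_swap_right swapped_values
  by auto

text \<open>After passing the outermost psi_(r+1), a y leaves this psi applied to a multiple of one
  of the vectors treated in \<open>swap_braid_zero\<close>, or to 0.\<close>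

lemma Y_dswap: "s \<in> {1..n} \<Longrightarrow> Y s (dswap r x) = 0"
  using YP_left[OF W_swap_both, of "r + 1"] YP_right[OF W_swap_both, of "r + 1"] YP_far[OF W_swap_both, of "r + 1" s]
    r Y_swap_both swapped_values swap_braid_zero
  by (cases "s = r + 1"; cases "s = r + 2") (auto simp: dswap_def numeral_eq_Suc)

lemma dswap_W: "dswap r x \<in> W (alt_seq n)"
  using PW[OF W_swap_both, of "r + 1"] r by (simp add: dswap_def)

lemma P_dswap_far: "s \<in> {1..<n} \<Longrightarrow> s + 1 < r \<or> r + 3 < s \<Longrightarrow> P s (dswap r x) = dswap r (P s x)"
  using PP_far[OF W_swap_both, of "r + 1" s] PP_far[OF W_swap_right, of r s] PP_far[OF W_swap, of "r + 2" s]
    PP_far[OF goodD(1), of "r + 1" s] r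
  by (auto simp: dswap_def)

text \<open>For \<open>s = r\<close> and \<open>s = r + 2\<close> two adjacent residues are equal,
  so the braid relation has no correction term, and its other side contains a product that is 0 by
  \<open>swap_braid_zero\<close>.\<close>

lemma P_dswap_even: assumes s: "s \<in> {1..<n}" "even s" shows "P s (dswap r x) = 0"
proof -
  consider "s = r" | "s = r + 2" | "s + 1 < r \<or> r + 3 < s"
    using s(2) r(1) by atomize_elim presburger
  then show ?thesis
  proof cases
    case 1
    then show ?thesis
      using braid[OF W_swap_right, of r] swapped_values r swap_braid_zero by (simp add: dswap_def)
  next
    case 2
    then show ?thesis
      using braid[OF W_swap_left, of "r + 1"] swapped_values r swap_braid_zero swap_left_right_commute
      by (simp add: dswap_def numeral_eq_Suc)
  next
    case 3
    then show ?thesis using P_dswap_far[OF s(1) 3] goodD(3)[OF s] by (simp add: dswap_def)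
  qed
qed

lemma dswap_good: "dswap r x \<in> good"
  using dswap_W Y_dswap P_dswap_even by (auto simp: good_def)

text \<open>Here psi_(r+1) occurs twice in succession, between different residues, and becomes
  -(y_(r+1) - y_(r+2))^2. The two squares contribute 0 and each of the two mixed terms contributes
  \<open>P (r + 1) x\<close>, whence the factor -2.\<close>

lemma P_dswap: "P (r + 1) (dswap r x) = - 2 * P (r + 1) x"
proof -
  have "Y (r + 1) (P r (P (r + 1) x)) = P (r + 1) x" "Y (r + 2) (P r (P (r + 1) x)) = 0"
    "Y (r + 2) (P (r + 2) (P (r + 1) x)) = - P (r + 1) x" "Y (r + 1) (P (r + 2) (P (r + 1) x)) = 0"
    using Y_swap_left[of "r + 1"] Y_swap_left[of "r + 2"] Y_swap_right[of "r + 1"] Y_swap_right[of "r + 2"] r by auto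
  then show ?thesis
    using PP_diff[OF W_swap_both, of "r + 1"] swapped_values r Y_swap_both[of "r + 1"] Y_swap_both[of "r + 2"] 
    by (simp add: dswap_def mult_2)
qed

end

text \<open>The alternating braid relation is used twice, on \<open>t\<close> and then on
  \<open>b\<close>. Each time the opposite braid product is 0 and a single correction term y
  survives. The first correction removes three letters, the second turns what is left into
  \<open>P (r + 1) x\<close>.\<close>

lemma TL_up:
  assumes r: "even r" "0 < r" "r + 5 \<le> n" and x: "x \<in> good" and kill: "P (r + 3) x = 0"
  shows "P (r + 1) (dswap (r + 2) (dswap r x)) = P (r + 1) x"
proof -
  have r3: "r + 3 \<le> n" using r by simp
  note facts = r(1,2) r3 x
  let ?j = "swap_seq (r + 1) (alt_seq n)"
  have jv: "?j (r + 1) = 1" "?j (r + 2) = 0" "?j (r + 3) = 0" "?j (r + 4) = 1" "?j (r + 5) = 0"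
    using r by (auto simp: alt_seq_def swap_seq_def transpose_def)
  note xW = goodD(1)[OF facts] and swapW = W_swap[OF facts] and aW = W_swap_left[OF facts] and bW = W_swap_right[OF facts]
    and cW = W_swap_both[OF facts]
  define a where "a = P r (P (r + 1) x)"
  define b where "b = P (r + 2) (P (r + 1) x)"
  define c where "c = P r b"
  define t where "t = P (r + 4) (P (r + 3) c)"
  have cW: "c \<in> W ?j" using cW by (simp add: b_def c_def)
  have aW: "a \<in> W ?j" and bW: "b \<in> W ?j" using aW bW by (simp_all add: a_def b_def)
  have c_a: "c = P (r + 2) a" using swap_left_right_commute[OF facts] by (simp add: a_def b_def c_def)
  have dW: "P (r + 3) c \<in> W (swap_seq (r + 3) ?j)" using PW[OF cW, of "r + 3"] r by simp
  have tW: "t \<in> W (swap_seq (r + 4) (swap_seq (r + 3) ?j))"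
    using PW[OF dW, of "r + 4"] r by (simp add: t_def)
  have tv: "swap_seq (r + 4) (swap_seq (r + 3) ?j) (r + 1) = 1"
    "swap_seq (r + 4) (swap_seq (r + 3) ?j) (r + 2) = 0"
    "swap_seq (r + 4) (swap_seq (r + 3) ?j) (r + 3) = 1"
    using r by (auto simp: alt_seq_def swap_seq_def transpose_def)
  have "P (r + 3) a = P r (P (r + 3) (P (r + 1) x))"
    using PP_far[OF swapW, of r "r + 3"] r by (simp add: a_def)
  also have "P (r + 3) (P (r + 1) x) = 0"
    using PP_far[OF xW, of "r + 1" "r + 3"] r kill by simp
  finally have P3a: "P (r + 3) a = 0" by simp
  \<comment> \<open>The residues at \<open>r + 2\<close> and \<open>r + 3\<close> are both 0, so the
    braid relation is exact. Its other side begins by applying psi_(r+3) to \<open>a\<close>, which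
    is 0 because of \<open>kill\<close>.\<close>
  have "P (r + 2) t = P (r + 4) (P (r + 2) (P (r + 3) (P (r + 2) a)))"
    using PP_far[OF dW, of "r + 4" "r + 2"] r by (simp add: t_def c_a)
  also have "P (r + 2) (P (r + 3) (P (r + 2) a)) = 0"
    using braid[OF aW, of "r + 2"] r jv P3a by (simp add: numeral_eq_Suc)
  finally have P2t: "P (r + 2) t = 0" by simp
  have Yc: "Y (r + 1) c = b" "Y (r + 2) c = - a" "Y (r + 4) c = 0"
    using Y_swap_both[OF facts, of "r + 1"] Y_swap_both[OF facts, of "r + 2"] Y_swap_both[OF facts, of "r + 4"] r
    by (simp_all add: a_def b_def c_def)
  have Yt1: "Y (r + 1) t = P (r + 4) (P (r + 3) b)"
    using YP_far[OF dW, of "r + 4" "r + 1"] YP_far[OF cW, of "r + 3" "r + 1"] r Yc by (simp add: t_def)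
  have Yt2: "Y (r + 2) t = 0"
    using YP_far[OF dW, of "r + 4" "r + 2"] YP_far[OF cW, of "r + 3" "r + 2"] r Yc P3a by (simp add: t_def)
  have Yt3: "Y (r + 3) t = 0"
    using YP_far[OF dW, of "r + 4" "r + 3"] YP_left[OF cW, of "r + 3"] r Yc jv
    by (simp add: t_def numeral_eq_Suc)
  have t: "P (r + 1) (P (r + 2) (P (r + 1) t)) = P (r + 4) (P (r + 3) b)"
    using braid_alt[OF tW, of "r + 1"] r tv P2t Yt1 Yt2 Yt3 by (simp add: numeral_eq_Suc)
  have P1t: "P (r + 1) t \<in> W (swap_seq (r + 1) (swap_seq (r + 4) (swap_seq (r + 3) ?j)))"
    using PW[OF tW, of "r + 1"] r by simp
  have P2P1t: "P (r + 2) (P (r + 1) t) \<in>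
      W (swap_seq (r + 2) (swap_seq (r + 1) (swap_seq (r + 4) (swap_seq (r + 3) ?j))))"
    using PW[OF P1t, of "r + 2"] r by simp
  have "dswap (r + 2) (dswap r x) = P (r + 3) (P (r + 2) (P (r + 4) (P (r + 3) (P (r + 1) c))))"
    by (simp add: dswap_def b_def c_def numeral_eq_Suc)
  also have "P (r + 4) (P (r + 3) (P (r + 1) c)) = P (r + 1) t"
    using PP_far[OF cW, of "r + 1" "r + 3"] PP_far[OF dW, of "r + 1" "r + 4"] r by (simp add: t_def)
  finally have "P (r + 1) (dswap (r + 2) (dswap r x)) = P (r + 3) (P (r + 1) (P (r + 2) (P (r + 1) t)))"
    using PP_far[OF P2P1t, of "r + 1" "r + 3"] r by simp
  also have "\<dots> = P (r + 3) (P (r + 4) (P (r + 3) b))" by (simp only: t)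
  also have "\<dots> = Y (r + 3) b"
  proof -
    have "P (r + 4) (P (r + 1) x) = 0"
      using PP_far[OF xW, of "r + 1" "r + 4"] r goodD(3)[OF facts, of "r + 4"] by simp
    then have "P (r + 4) b = 0"
      using PP_far[OF swapW, of "r + 2" "r + 4"] r by (simp add: b_def)
    moreover have "Y (r + 4) b = 0" "Y (r + 5) b = 0"
      using Y_swap_right[OF facts, of "r + 4"] Y_swap_right[OF facts, of "r + 5"] r by (simp_all add: b_def)
    ultimately show ?thesis
      using braid_alt[OF bW, of "r + 3"] r jv by (simp add: numeral_eq_Suc)
  qed
  also have "\<dots> = P (r + 1) x"
    using Y_swap_right[OF facts, of "r + 3"] r by (simp add: b_def)
  finally show ?thesis .
qed

text \<open>The mirror image of \<open>TL_up\<close>. The vanishing product is now the left side of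
  \<open>braid_alt\<close>, so each correction enters with a minus sign; this is cancelled by the
  sign of y_(r+4) on \<open>c\<close> and of y_(r+2) on \<open>b\<close>.\<close>

lemma TL_down:
  assumes r: "even r" "0 < r" "r + 5 \<le> n" and x: "x \<in> good" and kill: "P (r + 1) x = 0"
  shows "P (r + 3) (dswap r (dswap (r + 2) x)) = P (r + 3) x"
proof -
  have r2: "even (r + 2)" "0 < r + 2" "r + 2 + 3 \<le> n" using r by simp_all
  note facts = r2 x
  let ?j = "swap_seq (r + 3) (alt_seq n)"
  have jv: "?j r = 1" "?j (r + 1) = 0" "?j (r + 2) = 1" "?j (r + 3) = 1"
    using r by (auto simp: alt_seq_def swap_seq_def transpose_def)
  have num: "r + 2 + 1 = r + 3" "r + 2 + 2 = r + 4" "r + 2 + 3 = r + 5" by simp_all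
  note xW = goodD(1)[OF facts] and swapW = W_swap[OF facts, unfolded num]
  define a where "a = P (r + 4) (P (r + 3) x)"
  define b where "b = P (r + 2) (P (r + 3) x)"
  define c where "c = P (r + 2) a"
  define s where "s = P (r + 1) c"
  define t where "t = P r s"
  note Yc' = Y_swap_both[OF facts, unfolded num, folded a_def b_def, folded c_def]
    and Yb' = Y_swap_left[OF facts, unfolded num, folded b_def]
  have aW: "a \<in> W ?j" and bW: "b \<in> W ?j" and cW: "c \<in> W ?j"
    using W_swap_right[OF facts] W_swap_left[OF facts] W_swap_both[OF facts] unfolding a_def b_def c_def num by blast+
  have sW: "s \<in> W (swap_seq (r + 1) ?j)" using PW[OF cW, of "r + 1"] r by (simp add: s_def)
  have tW: "t \<in> W (swap_seq r (swap_seq (r + 1) ?j))" using PW[OF sW, of r] r by (simp add: t_def)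
  have tv: "swap_seq r (swap_seq (r + 1) ?j) (r + 2) = 0"
    "swap_seq r (swap_seq (r + 1) ?j) (r + 3) = 1"
    "swap_seq r (swap_seq (r + 1) ?j) (r + 4) = 0"
    using r by (auto simp: alt_seq_def swap_seq_def transpose_def)
  have "P (r + 1) (P (r + 3) x) = 0"
    using PP_far[OF xW, of "r + 3" "r + 1"] r kill by simp
  then have P1a: "P (r + 1) a = 0"
    using PP_far[OF swapW, of "r + 4" "r + 1"] r by (simp add: a_def)
  have "P (r + 2) t = P r (P (r + 2) (P (r + 1) (P (r + 2) a)))"
    using PP_far[OF sW, of r "r + 2"] r by (simp add: s_def t_def c_def)
  also have "P (r + 2) (P (r + 1) (P (r + 2) a)) = 0"
    using braid[OF aW, of "r + 1"] r jv P1a by (simp add: numeral_eq_Suc)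
  finally have P2t: "P (r + 2) t = 0" by simp
  have Yc: "Y (r + 1) c = 0" "Y (r + 3) c = a" "Y (r + 4) c = - b"
    using Yc'[of "r + 1"] Yc'[of "r + 3"] Yc'[of "r + 4"] r by simp_all
  have Yt2: "Y (r + 2) t = 0"
    using YP_far[OF sW, of r "r + 2"] YP_right[OF cW, of "r + 1"] r Yc jv
    by (simp add: s_def t_def numeral_eq_Suc)
  have Yt3: "Y (r + 3) t = 0"
    using YP_far[OF sW, of r "r + 3"] YP_far[OF cW, of "r + 1" "r + 3"] r Yc P1a
    by (simp add: s_def t_def)
  have Yt4: "Y (r + 4) t = - P r (P (r + 1) b)"
    using YP_far[OF sW, of r "r + 4"] YP_far[OF cW, of "r + 1" "r + 4"] r Yc
    by (simp add: s_def t_def)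
  have t: "P (r + 3) (P (r + 2) (P (r + 3) t)) = P r (P (r + 1) b)"
    using braid_alt[OF tW, of "r + 2"] r tv P2t Yt2 Yt3 Yt4 by (simp add: numeral_eq_Suc)
  have P3s: "P (r + 3) s \<in> W (swap_seq (r + 3) (swap_seq (r + 1) ?j))"
    using PW[OF sW, of "r + 3"] r by simp
  have P3t: "P (r + 3) t \<in> W (swap_seq (r + 3) (swap_seq r (swap_seq (r + 1) ?j)))"
    using PW[OF tW, of "r + 3"] r by simp
  have P2P3t: "P (r + 2) (P (r + 3) t) \<in>
      W (swap_seq (r + 2) (swap_seq (r + 3) (swap_seq r (swap_seq (r + 1) ?j))))"
    using PW[OF P3t, of "r + 2"] r by simp
  have "dswap r (dswap (r + 2) x) = P (r + 1) (P r (P (r + 2) (P (r + 1) (P (r + 3) c))))"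
    by (simp only: dswap_def num a_def c_def)
  also have "P (r + 1) (P (r + 3) c) = P (r + 3) s"
    using PP_far[OF cW, of "r + 3" "r + 1"] r by (simp add: s_def)
  also have "P r (P (r + 2) (P (r + 3) s)) = P (r + 2) (P (r + 3) t)"
    using PP_far[OF P3s, of "r + 2" r] PP_far[OF sW, of "r + 3" r] r by (simp add: t_def)
  finally have "P (r + 3) (dswap r (dswap (r + 2) x)) = P (r + 1) (P (r + 3) (P (r + 2) (P (r + 3) t)))"
    using PP_far[OF P2P3t, of "r + 1" "r + 3"] r by simp
  also have "\<dots> = P (r + 1) (P r (P (r + 1) b))" by (simp only: t)
  also have "\<dots> = - Y (r + 2) b"
  proof -
    have "P r (P (r + 3) x) = 0"
      using PP_far[OF xW, of "r + 3" r] r goodD(3)[OF facts, of r] by simp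
    then have "P r b = 0"
      using PP_far[OF swapW, of "r + 2" r] r by (simp add: b_def)
    moreover have "Y r b = 0" "Y (r + 1) b = 0"
      using Yb'[of r] Yb'[of "r + 1"] r by simp_all
    ultimately show ?thesis
      using braid_alt[OF bW, of r] r jv by (simp add: numeral_eq_Suc eq_neg_iff_add_eq_0)
  qed
  also have "\<dots> = P (r + 3) x"
    using Yb'[of "r + 2"] r by simp
  finally show ?thesis .
qed

end

text \<open>Here \<open>x t\<close> arises from \<open>x 0\<close> by moving a domino \<open>t\<close> places, and \<open>f s\<close> and \<open>g s\<close> are the actions of
  the $\phi_k$ and $\Psi_k$ that belong to the \<open>s\<close>-th of these moves. The sum has at most three
  nonzero terms, and these form a second difference of a linear function.\<close>

lemma chain_sum_zero:
  fixes f g :: "nat \<Rightarrow> 'm \<Rightarrow> 'm::ring_1" and x :: "nat \<Rightarrow> 'm"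
  assumes G: "\<And>t. t \<le> T \<Longrightarrow> x t \<in> G"
    and step: "\<And>t. t < T \<Longrightarrow> x (Suc t) = g t (x t)"
    and f_zero: "\<And>s. f s 0 = 0" and g_zero: "\<And>s. g s 0 = 0"
    and double: "\<And>s y. s < T \<Longrightarrow> y \<in> G \<Longrightarrow> f s (g s y) = - 2 * f s y"
    and TL: "\<And>s y. Suc s < T \<Longrightarrow> y \<in> G \<Longrightarrow> f (Suc s) y = 0 \<Longrightarrow> f s (g (Suc s) (g s y)) = f s y"
    and far: "\<And>s t y. s < T \<Longrightarrow> t < T \<Longrightarrow> y \<in> G \<Longrightarrow> Suc s < t \<or> Suc t < s \<Longrightarrow> f s (g t y) = g t (f s y)"
    and factor: "\<And>s y. s < T \<Longrightarrow> y \<in> G \<Longrightarrow> f s y = 0 \<Longrightarrow> g s y = 0"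
    and start: "\<And>s. 0 < s \<Longrightarrow> s < T \<Longrightarrow> f s (x 0) = 0"
    and s: "s < T"
  shows "(\<Sum>t\<le>T. of_nat (T + 1 - t) * f s (x t)) = 0"
proof -
  have early: "f s (x t) = 0" if "t < s" "s < T" for s t
    using that(1)
  proof (induction t)
    case 0
    then show ?case using start that(2) by simp
  next
    case (Suc t)
    then show ?case using step[of t] far[of s t "x t"] G[of t] that(2) g_zero by simp
  qed
  have two: "f s (x (Suc (Suc s))) = f s (x s)" if "Suc s < T"
    using that step[of s] step[of "Suc s"] TL[of s "x s"] G[of s] early[of s "Suc s"] by simp
  \<comment> \<open>At \<open>s + 3\<close> the move \<open>g (s + 2)\<close> commutes with
    \<open>f s\<close>. By \<open>two\<close> it then acts on \<open>f s (x s)\<close>, and it can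
    be moved back inside, where it meets \<open>x s\<close>. This vector is killed by
    \<open>f (s + 2)\<close>, hence by \<open>g (s + 2)\<close>. All later moves merely commute with
    \<open>f s\<close>.\<close>
  have late: "f s (x t) = 0" if "s + 3 \<le> t" "t \<le> T" for t
    using that
  proof (induction t rule: nat_induct_at_least)
    case base
    have "f s (x (s + 3)) = g (s + 2) (f s (x (s + 2)))"
      using base step[of "s + 2"] far[of s "s + 2" "x (s + 2)"] G[of "s + 2"] by (simp add: numeral_eq_Suc)
    also have "\<dots> = g (s + 2) (f s (x s))" using two base by (simp add: numeral_eq_Suc)
    also have "\<dots> = f s (g (s + 2) (x s))" using far[of s "s + 2" "x s"] G[of s] base by simp
    also have "g (s + 2) (x s) = 0" using factor[of "s + 2" "x s"] G[of s] early[of s "s + 2"] base by simp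
    finally show ?case using f_zero by simp
  next
    case (Suc t)
    then show ?case using step[of t] far[of s t "x t"] G[of t] s g_zero by simp
  qed
  define w where "w = f s (x s)"
  have F: "f s (x t) = (if t = s then w else 0) + (if t = s + 1 then - 2 * w else 0)
      + (if t = s + 2 then w else 0)" if "t \<le> T" for t
  proof -
    consider "t < s" | "t = s" | "t = s + 1" | "t = s + 2" | "s + 3 \<le> t" by linarith
    then show ?thesis
    proof cases
      case 1 then show ?thesis using early s by simp
    next
      case 2 then show ?thesis by (simp add: w_def)
    next
      case 3 then show ?thesis using step[of s] double[of s "x s"] G[of s] s by (simp add: w_def)
    next
      case 4 then show ?thesis using two that by (simp add: w_def)
    next
      case 5 then show ?thesis using late that by simp
    qed
  qed
  \<comment> \<open>The weights at \<open>s\<close>, \<open>s + 1\<close>, \<open>s + 2\<close> are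
    \<open>d + 2\<close>, \<open>d + 1\<close>, \<open>d\<close>. If \<open>d = 0\<close>, the index
    \<open>s + 2\<close> is outside the range, and the missing term would have had weight 0.\<close>
  obtain d where d: "T = s + 1 + d" using s by (metis add.commute add_Suc_right less_imp_Suc_add Suc_eq_plus1)
  have "(\<Sum>t\<le>T. of_nat (T + 1 - t) * f s (x t)) =
    (\<Sum>t\<le>T. (if t = s then of_nat (d + 2) * w else 0) + (if t = s + 1 then of_nat (d + 1) * (- 2 * w) else 0)
      + (if t = s + 2 then of_nat d * w else 0))"
    by (rule sum.cong) (auto simp: F d)
  also have "\<dots> = of_nat (d + 2) * w + (of_nat (d + 1) * (- 2 * w)) + of_nat d * w"
    by (cases d) (auto simp: sum.distrib d)
  also have "\<dots> = 0" by (simp add: algebra_simps mult_2)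
  finally show ?thesis .
qed

definition dswap_word :: "nat \<Rightarrow> nat list" where
  "dswap_word r = [r + 1, r, r + 2, r + 1]"

text \<open>Words act from the right end. At first the places raising to \<open>m\<close> carry leg dominoes and the others arm
  dominoes. Then \<open>right_word m t\<close> moves the leg domino at \<open>m\<close> to \<open>m + t\<close>, and \<open>left_word m s\<close> moves an arm domino
  at \<open>m\<close> to \<open>m - s\<close>.\<close>

fun right_word :: "nat \<Rightarrow> nat \<Rightarrow> nat list" where
  "right_word m 0 = []"
| "right_word m (Suc t) = dswap_word (2 * (m + t)) @ right_word m t"

fun left_word :: "nat \<Rightarrow> nat \<Rightarrow> nat list" where
  "left_word m 0 = []"
| "left_word m (Suc t) = dswap_word (2 * (m - 1 - t)) @ left_word m t"

section \<open>Actions of words\<close>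

context klr_action
begin

abbreviation act :: "nat list \<Rightarrow> 'm \<Rightarrow> 'm" where "act \<equiv> foldr P"

lemma act_add: "act ws (x + y) = act ws x + act ws y"
  by (induction ws) (simp_all add: P_add)

lemma act_zero [simp]: "act ws 0 = 0"
  by (induction ws) simp_all

lemma act_of_nat: "act ws (of_nat c * x) = of_nat c * act ws x"
  by (induction c) (simp_all add: algebra_simps act_add)

lemma act_sum: "act ws (sum f A) = (\<Sum>a\<in>A. act ws (f a))"
  by (induction A rule: infinite_finite_induct) (simp_all add: act_add)

lemma P_sum: "P r (sum f A) = (\<Sum>a\<in>A. P r (f a))"
  using act_sum[of "[r]"] by simp

lemma P_of_nat: "P r (of_nat c * x) = of_nat c * P r x"
  using act_of_nat[of "[r]"] by simp

lemma act_dswap_word: "act (dswap_word r) x = dswap r x"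
  by (simp add: dswap_word_def dswap_def)

lemma dswap_eq_0: "P (r + 1) x = 0 \<Longrightarrow> dswap r x = 0"
  by (simp add: dswap_def)

lemma good_zero: "0 \<in> good"
  by (simp add: good_def W_zero)

lemma good_add: "x \<in> good \<Longrightarrow> y \<in> good \<Longrightarrow> x + y \<in> good"
  by (auto simp: good_def W_add Y_add P_add)

lemma good_of_nat: "x \<in> good \<Longrightarrow> of_nat c * x \<in> good"
  by (induction c) (auto simp: algebra_simps good_zero good_add)

lemma good_sum: "(\<And>a. a \<in> A \<Longrightarrow> f a \<in> good) \<Longrightarrow> sum f A \<in> good"
  by (induction A rule: infinite_finite_induct) (auto simp: good_zero good_add)

text \<open>The letter \<open>k\<close> acts first. Each letter carries the entry that was at place
  \<open>k + 1\<close> one place further to the left, until it is at place 1.\<close>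

lemma W_cycle: "x \<in> W i \<Longrightarrow> k < n \<Longrightarrow> \<exists>i'. act [1..<k + 1] x \<in> W i' \<and> i' 1 = i (k + 1)"
proof (induction k arbitrary: x i)
  case (Suc k)
  then have "P (k + 1) x \<in> W (swap_seq (k + 1) i)" using PW[of x i "k + 1"] by simp
  from Suc.IH[OF this] Suc.prems(2)
  obtain i' where "act [1..<k + 1] (P (k + 1) x) \<in> W i'" "i' 1 = swap_seq (k + 1) i (k + 1)" by auto
  then show ?case by (intro exI[of _ i']) (simp add: swap_seq_def)
qed auto

lemma cycle_zero:
  assumes "x \<in> W i" "k < n" "i (k + 1) = 1" shows "act [1..<k + 1] x = 0"
  using W_cycle[OF assms(1,2)] W_first assms(3) by auto

section \<open>The image of z and the relations that it satisfies\<close>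

context
  fixes N m z
  assumes n: "n = 2 * N + 1" and m: "0 < m" "m < N"
    and z: "z \<in> good" and Pz_all: "\<forall>k. 0 < k \<and> k < N \<and> k \<noteq> m \<longrightarrow> P (2 * k + 1) z = 0"
begin

lemma Pz: "0 < k \<Longrightarrow> k < N \<Longrightarrow> k \<noteq> m \<Longrightarrow> P (2 * k + 1) z = 0"
  using Pz_all by blast

lemma domino_good: "0 < k \<Longrightarrow> k < N \<Longrightarrow> x \<in> good \<Longrightarrow> dswap (2 * k) x \<in> good"
  using dswap_good[of "2 * k" x] n by simp

lemma domino_double: "0 < k \<Longrightarrow> k < N \<Longrightarrow> x \<in> good \<Longrightarrow> P (2 * k + 1) (dswap (2 * k) x) = - 2 * P (2 * k + 1) x"
  using P_dswap[of "2 * k" x] n by simp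

lemma domino_far: "0 < k \<Longrightarrow> k < N \<Longrightarrow> x \<in> good \<Longrightarrow> 0 < l \<Longrightarrow> l < N \<Longrightarrow> k + 1 < l \<or> l + 1 < k \<Longrightarrow>
    P (2 * l + 1) (dswap (2 * k) x) = dswap (2 * k) (P (2 * l + 1) x)"
  using P_dswap_far[of "2 * k" x "2 * l + 1"] n by auto

lemma succ_domino: "2 * (k + 1) = 2 * k + 2" "2 * k + 2 + 1 = 2 * k + (3 :: nat)"
  by simp_all

lemma domino_up: "0 < k \<Longrightarrow> k + 1 < N \<Longrightarrow> x \<in> good \<Longrightarrow> P (2 * (k + 1) + 1) x = 0 \<Longrightarrow>
    P (2 * k + 1) (dswap (2 * (k + 1)) (dswap (2 * k) x)) = P (2 * k + 1) x"
  using TL_up[of "2 * k" x] n unfolding succ_domino by auto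

lemma domino_down: "0 < k \<Longrightarrow> k + 1 < N \<Longrightarrow> x \<in> good \<Longrightarrow> P (2 * k + 1) x = 0 \<Longrightarrow>
    P (2 * (k + 1) + 1) (dswap (2 * k) (dswap (2 * (k + 1)) x)) = P (2 * (k + 1) + 1) x"
  using TL_down[of "2 * k" x] n unfolding succ_domino by auto

lemma right_word_good: "m + t \<le> N \<Longrightarrow> act (right_word m t) z \<in> good"
  using z m domino_good[of "m + t" for t] by (induction t) (auto simp: act_dswap_word)

lemma left_word_good: "t < m \<Longrightarrow> x \<in> good \<Longrightarrow> act (left_word m t) x \<in> good"
  using domino_good[of "m - 1 - t" for t] m by (induction t) (auto simp: act_dswap_word)

text \<open>For a fixed final place of the leg domino, \<open>chain_sum_zero\<close> is applied to
  the leftward moves. They are numbered from \<open>m\<close> downwards: the \<open>s\<close>-th one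
  is Psi_(m-1-s), so the weight \<open>m - s\<close> is the coefficient p.\<close>

lemma left_zero:
  assumes "0 < k" "k < m" "t \<le> N - m - 1"
  shows "(\<Sum>s\<le>m - 1. of_nat (m - s) * P (2 * k + 1) (act (left_word m s) (act (right_word m (Suc t)) z))) = 0"
proof -
  let ?x = "\<lambda>s. act (left_word m s) (act (right_word m (Suc t)) z)"
  \<comment> \<open>The right words use only Psi_l with l at least \<open>m\<close>. These commute
    with the given phi, which kills \<open>z\<close>.\<close>
  have base: "P (2 * l + 1) (act (right_word m t') z) = 0" if "0 < l" "l + 1 < m" "m + t' \<le> N" for l t'
    using that
  proof (induction t')
    case 0
    then show ?case using Pz[of l] m by simp
  next
    case (Suc t')
    then show ?case
      using domino_far[of "m + t'" "act (right_word m t') z" l] right_word_good[of t'] m dswap_eq_0 by (simp add: act_dswap_word dswap_def)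
  qed
  have "(\<Sum>s\<le>m - 1. of_nat (m - 1 + 1 - s) * P (2 * (m - 1 - (m - 1 - k)) + 1) (?x s)) = 0"
  proof (rule chain_sum_zero[where G = good and g = "\<lambda>s. dswap (2 * (m - 1 - s))"
        and f = "\<lambda>s. P (2 * (m - 1 - s) + 1)" and x = ?x])
    show "?x s \<in> good" if "s \<le> m - 1" for s
      using left_word_good right_word_good[of "Suc t"] that assms m by simp
  next
    fix s y assume *: "s < m - 1" "y \<in> good"
    show "P (2 * (m - 1 - s) + 1) (dswap (2 * (m - 1 - s)) y) = - 2 * P (2 * (m - 1 - s) + 1) y"
      using domino_double[of "m - 1 - s" y] * m by simp
    show "dswap (2 * (m - 1 - s)) y = 0" if "P (2 * (m - 1 - s) + 1) y = 0"
      using dswap_eq_0 that by simp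
  next
    fix s y assume *: "Suc s < m - 1" "y \<in> good" "P (2 * (m - 1 - Suc s) + 1) y = 0"
    have "m - 1 - s = (m - 1 - Suc s) + 1" using * by simp
    then show "P (2 * (m - 1 - s) + 1) (dswap (2 * (m - 1 - Suc s)) (dswap (2 * (m - 1 - s)) y))
        = P (2 * (m - 1 - s) + 1) y"
      using domino_down[of "m - 1 - Suc s" y] * m by simp
  next
    fix s s' y assume *: "s < m - 1" "s' < m - 1" "y \<in> good" "Suc s < s' \<or> Suc s' < s"
    show "P (2 * (m - 1 - s) + 1) (dswap (2 * (m - 1 - s')) y) = dswap (2 * (m - 1 - s')) (P (2 * (m - 1 - s) + 1) y)"
      by (rule domino_far) (use * m in auto)
  next
    fix s assume *: "0 < s" "s < m - 1"
    then show "P (2 * (m - 1 - s) + 1) (?x 0) = 0"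
      using base[of "m - 1 - s" "Suc t"] assms m by simp
  qed (use assms in \<open>auto simp: act_dswap_word dswap_def\<close>)
  then show ?thesis using assms by simp
qed

text \<open>The chain starts at Psi_m z and not at \<open>z\<close>, since phi_m need not kill
  \<open>z\<close>; hence \<open>Suc t\<close>, with the \<open>s\<close>-th move
  Psi_(m+1+s).\<close>

lemma right_zero:
  assumes "m < k" "k < N"
  shows "(\<Sum>t\<le>N - m - 1. of_nat (N - m - t) * P (2 * k + 1) (act (right_word m (Suc t)) z)) = 0"
proof -
  let ?x = "\<lambda>t. act (right_word m (Suc t)) z" and ?T = "N - m - 1"
  have "(\<Sum>t\<le>?T. of_nat (?T + 1 - t) * P (2 * (m + 1 + (k - m - 1)) + 1) (?x t)) = 0"
  proof (rule chain_sum_zero[where G = good and g = "\<lambda>s. dswap (2 * (m + 1 + s))"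
        and f = "\<lambda>s. P (2 * (m + 1 + s) + 1)" and x = ?x])
    show "?x t \<in> good" if "t \<le> ?T" for t
      using right_word_good[of "Suc t"] that m by simp
  next
    fix s y assume *: "s < ?T" "y \<in> good"
    show "P (2 * (m + 1 + s) + 1) (dswap (2 * (m + 1 + s)) y) = - 2 * P (2 * (m + 1 + s) + 1) y"
      by (rule domino_double) (use * m in auto)
    show "dswap (2 * (m + 1 + s)) y = 0" if "P (2 * (m + 1 + s) + 1) y = 0"
      using dswap_eq_0 that by simp
  next
    fix s y assume *: "Suc s < ?T" "y \<in> good" "P (2 * (m + 1 + Suc s) + 1) y = 0"
    then show "P (2 * (m + 1 + s) + 1) (dswap (2 * (m + 1 + Suc s)) (dswap (2 * (m + 1 + s)) y))
        = P (2 * (m + 1 + s) + 1) y"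
      using domino_up[of "m + 1 + s" y] by simp
  next
    fix s s' y assume *: "s < ?T" "s' < ?T" "y \<in> good" "Suc s < s' \<or> Suc s' < s"
    show "P (2 * (m + 1 + s) + 1) (dswap (2 * (m + 1 + s')) y) = dswap (2 * (m + 1 + s')) (P (2 * (m + 1 + s) + 1) y)"
      by (rule domino_far) (use * m in auto)
  next
    fix s assume *: "0 < s" "s < ?T"
    have "P (2 * (m + 1 + s) + 1) (dswap (2 * m) z) = dswap (2 * m) (P (2 * (m + 1 + s) + 1) z)"
      by (rule domino_far) (use * m z in auto)
    then show "P (2 * (m + 1 + s) + 1) (?x 0) = 0"
      using Pz[of "m + 1 + s"] * by (simp add: act_dswap_word dswap_def)
  qed (use assms in \<open>auto simp: act_dswap_word dswap_def\<close>)
  then show ?thesis using assms by simp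
qed

text \<open>With p = m - s and q = m + t + 1 the coefficient is p (N+1-q). The right word has length
  index at least 1 because q > m.\<close>

definition endo_vec where
  "endo_vec = (\<Sum>s\<le>m - 1. \<Sum>t\<le>N - m - 1. of_nat ((m - s) * (N - m - t)) * act (left_word m s @ right_word m (Suc t)) z)"

lemma endo_vec_good: "endo_vec \<in> good"
  unfolding endo_vec_def foldr_append comp_def using m by (intro good_sum good_of_nat left_word_good right_word_good) auto

lemma endo_vec_W: "endo_vec \<in> W (alt_seq n)"
  using endo_vec_good by (simp add: good_def)

text \<open>The left words use only Psi_l with l < m, which are far from phi_k.\<close>

lemma P_left_word: "m < k \<Longrightarrow> k < N \<Longrightarrow> s < m \<Longrightarrow> x \<in> good \<Longrightarrow>
    P (2 * k + 1) (act (left_word m s) x) = act (left_word m s) (P (2 * k + 1) x)"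
proof (induction s)
  case (Suc s)
  then have "P (2 * k + 1) (dswap (2 * (m - 1 - s)) (act (left_word m s) x))
      = dswap (2 * (m - 1 - s)) (P (2 * k + 1) (act (left_word m s) x))"
    using left_word_good[of s x] m by (intro domino_far) auto
  with Suc show ?case by (simp add: act_dswap_word)
qed simp

lemma P_endo_vec: 
  assumes r: "r \<in> {1..<n}" "r \<noteq> 2 * m + 1" shows "P r endo_vec = 0"
proof (cases "even r")
  case True
  then show ?thesis using endo_vec_good r by (simp add: good_def)
next
  case False
  then obtain k where k: "r = 2 * k + 1" by (elim oddE)
  consider "k = 0" | "0 < k" "k < m" | "m < k" "k < N" using k r n by fastforce
  then show ?thesis
  proof cases
    case 1
    have "act [1..<1 + 1] endo_vec = 0"
      by (rule cycle_zero[OF endo_vec_W]) (use n m in \<open>auto simp: alt_seq_def\<close>)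
    then show ?thesis using 1 k by simp
  next
    case 2
    \<comment> \<open>For k < m the sum over p is taken inside, with q fixed. For k > m it is the
      sum over q, after phi_k has been moved past the left word.\<close>
    have "P r endo_vec = (\<Sum>t\<le>N - m - 1. of_nat (N - m - t) *
        (\<Sum>s\<le>m - 1. of_nat (m - s) * P r (act (left_word m s) (act (right_word m (Suc t)) z))))"
      unfolding endo_vec_def P_sum P_of_nat sum_distrib_left
      by (subst sum.swap) (simp add: mult.assoc[symmetric] mult_of_nat_commute)
    also have "\<dots> = 0" using left_zero[OF 2] k by simp
    finally show ?thesis .
  next
    case 3
    have "P r endo_vec = (\<Sum>s\<le>m - 1. of_nat (m - s) *
        act (left_word m s) (\<Sum>t\<le>N - m - 1. of_nat (N - m - t) * P r (act (right_word m (Suc t)) z)))"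
      unfolding endo_vec_def P_sum P_of_nat sum_distrib_left act_sum act_of_nat
      by (intro sum.cong refl) (use P_left_word[OF 3] right_word_good k m in \<open>simp add: mult.assoc del: right_word.simps\<close>)
    also have "\<dots> = 0" using right_zero[OF 3] k by simp
    finally show ?thesis .
  qed
qed

text \<open>Place \<open>b + 2\<close> is even and so has residue 1; the cycle carries this residue
  to place 1.\<close>

lemma cycle_endo_vec: "act [1..<2 * m + 2] endo_vec = 0"
proof -
  have "alt_seq n (2 * m + 1 + 1) = 1" using n m by (simp add: alt_seq_def)
  then show ?thesis using cycle_zero[OF endo_vec_W, of "2 * m + 1"] n m by simp
qed

end

end

section \<open>Reduced words of Grassmannian permutations\<close>

text \<open>Read from the right end, each letter \<open>r\<close> replaces an element \<open>r\<close> of the current set by \<open>r + 1\<close>, which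
  leads from \<open>A0\<close> to \<open>A\<close>. For the sets of first column entries these are the reduced words.\<close>

fun raising :: "nat \<Rightarrow> nat set \<Rightarrow> nat list \<Rightarrow> nat set \<Rightarrow> bool" where
  "raising n A0 [] A \<longleftrightarrow> A = A0"
| "raising n A0 (r # rs) A \<longleftrightarrow>
     r \<in> {1..<n} \<and> r \<notin> A \<and> Suc r \<in> A \<and> raising n A0 rs (insert r (A - {Suc r}))"

lemma sum_move:
  assumes "finite A" "r \<notin> A" "Suc r \<in> A"
  shows "\<Sum>A = Suc (\<Sum>(insert r (A - {Suc r})))"
  using assms by (simp add: sum.remove[of A "Suc r"])

lemma card_move:
  assumes "finite A" "r \<notin> A" "Suc r \<in> A"
  shows "card (insert r (A - {Suc r})) = card A"
  using assms card_Suc_Diff1[of A "Suc r"] by simp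

text \<open>Each letter changes the sum of the set by exactly 1. So the two sets determine the
  length of the word, on which both the comparison of two words and the proof of minimal length
  rest.\<close>

lemma raising_sum: "raising n A0 rs A \<Longrightarrow> finite A0 \<Longrightarrow> finite A \<and> \<Sum>A = \<Sum>A0 + length rs"
proof (induction rs arbitrary: A)
  case (Cons r rs)
  let ?B = "insert r (A - {Suc r})"
  have "finite ?B" "\<Sum>?B = \<Sum>A0 + length rs" using Cons.IH[of ?B] Cons.prems by simp_all
  moreover from this(1) have "finite A" by simp
  ultimately show ?case using sum_move[of A r] Cons.prems by simp
qed simp

lemma raising_lists: "raising n A0 rs A \<Longrightarrow> rs \<in> lists {1..<n}"
  by (induction rs arbitrary: A) auto

text \<open>As long as some element can be lowered by 1 within the positive integers, lowering it
  decreases the sum. If none can, the set is closed downwards and hence equals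
  \<open>{1..k}\<close>. In \<open>raising_unique\<close> this supplies the common continuation of
  two words.\<close>

lemma raising_exists:
  "A \<subseteq> {1..n} \<Longrightarrow> card A = k \<Longrightarrow> \<exists>rs. raising n {1..k} rs A"
proof (induction "\<Sum>A" arbitrary: A rule: less_induct)
  case less
  have fin: "finite A" using less.prems finite_subset by blast
  show ?case
  proof (cases "\<exists>r\<ge>1. r \<notin> A \<and> Suc r \<in> A")
    case True
    then obtain r where r: "r \<ge> 1" "r \<notin> A" "Suc r \<in> A" by blast
    let ?B = "insert r (A - {Suc r})"
    have "\<Sum>?B < \<Sum>A" using sum_move[OF fin r(2,3)] by simp
    moreover have "?B \<subseteq> {1..n}" using less.prems r by auto
    moreover have "card ?B = k" using less.prems card_move[OF fin r(2,3)] by simp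
    ultimately obtain rs where "raising n {1..k} rs ?B" using less.hyps by blast
    then show ?thesis using r less.prems by (intro exI[of _ "r # rs"]) auto
  next
    case False
    have down: "y \<in> A" if "x \<in> A" "1 \<le> y" "y \<le> x" for x y
      using that(3,1,2) by (induction rule: inc_induct) (use False in auto)
    have "A = {1..card A}"
    proof (cases "A = {}")
      case False
      have "A = {1..Max A}"
        using down[OF Max_in[OF fin False]] Max_ge[OF fin] less.prems by auto
      then show ?thesis by (metis card_atLeastAtMost diff_Suc_1)
    qed simp
    then show ?thesis using less.prems by (intro exI[of _ "[]"]) simp
  qed
qed

context klr_action
begin

lemma act_W: "rs \<in> lists {1..<n} \<Longrightarrow> x \<in> W i \<Longrightarrow> \<exists>i'. act rs x \<in> W i'"
proof (induction rs)
  case (Cons r rs)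
  then show ?case using PW by fastforce
qed auto

text \<open>Two such words for \<open>A\<close> with different first letters \<open>r\<close>, \<open>r'\<close> have \<open>\<bar>r - r'\<bar> > 1\<close>, since \<open>A\<close> contains
  \<open>r + 1\<close> and \<open>r' + 1\<close> but neither \<open>r\<close> nor \<open>r'\<close>. So both can be replaced by words that continue from
  a common smaller set.\<close>

lemma raising_unique:
  assumes x: "x \<in> W i"
  shows "raising n {1..k} rs A \<Longrightarrow> raising n {1..k} rs' A \<Longrightarrow> A \<subseteq> {1..n} \<Longrightarrow> card A = k \<Longrightarrow> act rs x = act rs' x"
proof (induction "length rs" arbitrary: rs rs' A rule: less_induct)
  case less
  have fin: "finite A" using raising_sum less.prems by blast
  have len: "length rs = length rs'" using raising_sum less.prems by (metis add_left_cancel finite_atLeastAtMost)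
  show ?case
  proof (cases rs)
    case Nil
    then show ?thesis using len by simp
  next
    case (Cons r t)
    then obtain r' t' where rs': "rs' = r' # t'" using len by (cases rs') auto
    let ?B = "insert r (A - {Suc r})" and ?B' = "insert r' (A - {Suc r'})"
    have r: "r \<in> {1..<n}" "r \<notin> A" "Suc r \<in> A" "raising n {1..k} t ?B" using less.prems Cons by auto
    have r': "r' \<in> {1..<n}" "r' \<notin> A" "Suc r' \<in> A" "raising n {1..k} t' ?B'" using less.prems rs' by auto
    have B: "?B \<subseteq> {1..n}" "card ?B = k" using r less.prems card_move[OF fin r(2,3)] by auto
    have B': "?B' \<subseteq> {1..n}" "card ?B' = k" using r' less.prems card_move[OF fin r'(2,3)] by auto
    show ?thesis
    proof (cases "r = r'")
      case True
      then show ?thesis using less.hyps[of t ?B t'] r r' B Cons rs' by simp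
    next
      case False
      have far: "r' \<noteq> Suc r" "r \<noteq> Suc r'" using r r' by auto
      let ?C = "insert r' (?B - {Suc r'})"
      have C: "?C \<subseteq> {1..n}" "card ?C = k"
        using r' B fin far False card_move[of ?B r'] by auto
      from raising_exists[OF C] obtain s where s: "raising n {1..k} s ?C" by blast
      have C_eq: "?C = insert r (?B' - {Suc r})" using far False by auto
      have 1: "raising n {1..k} (r' # s) ?B" using s r' far False by auto
      have 2: "raising n {1..k} (r # s) ?B'" using s r far False unfolding C_eq by auto
      have "act t x = act (r' # s) x"
        using less.hyps[OF _ r(4) 1 B] Cons by simp
      moreover have "act (r # s) x = act t' x"
        using less.hyps[OF _ 2 r'(4) B'] raising_sum[OF 1] raising_sum[OF r(4)] Cons by simp
      moreover obtain i' where "act s x \<in> W i'" using act_W[OF raising_lists[OF s] x] by blast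
      then have "P r (P r' (act s x)) = P r' (P r (act s x))"
        using PP_far r(1) r'(1) far by simp
      ultimately show ?thesis using Cons rs' by simp
    qed
  qed
qed

end

section \<open>Permutations of raising words and minimality of length\<close>

lemma strict_mono_on_transpose:
  assumes "\<not> (r \<in> S \<and> Suc r \<in> S)" shows "strict_mono_on S (transpose r (Suc r))"
  using assms by (auto simp: strict_mono_on_def transpose_def Suc_lessI)

lemma strict_mono_on_comp: "strict_mono_on A f \<Longrightarrow> strict_mono_on (f ` A) g \<Longrightarrow> strict_mono_on A (g \<circ> f)"
  by (simp add: strict_mono_on_def)

text \<open>If the values at \<open>x\<close> differ, the smaller one is attained by the other
  function at an earlier point, where both functions already agree; this contradicts strict
  monotonicity.\<close>

lemma strict_mono_on_image_unique:
  fixes f g :: "'a::wellorder \<Rightarrow> 'b::linorder"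
  assumes f: "strict_mono_on A f" and g: "strict_mono_on A g" and eq: "f ` A = g ` A" and x: "x \<in> A"
  shows "f x = g x"
  using x
proof (induction x rule: less_induct)
  case (less x)
  have *: "\<not> f' x < g' x"
    if f': "strict_mono_on A f'" and g': "strict_mono_on A g'" and eq': "f' ` A = g' ` A"
      and IH: "\<And>y. y < x \<Longrightarrow> y \<in> A \<Longrightarrow> f' y = g' y"
    for f' g' :: "'a \<Rightarrow> 'b"
  proof
    assume lt: "f' x < g' x"
    obtain y where y: "y \<in> A" "f' x = g' y" using less.prems eq' by blast
    then have "y < x" using lt g' less.prems by (metis strict_mono_on_less)
    then show False using IH y f' less.prems by (metis strict_mono_onD less_irrefl)
  qed
  show ?case using *[OF f g eq] *[OF g f eq[symmetric]] less.IH by force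
qed

lemma word_perm_Nil [simp]: "word_perm [] = id"
  and word_perm_Cons [simp]: "word_perm (r # rs) = transpose r (Suc r) \<circ> word_perm rs"
  by (simp_all add: word_perm_def)

lemma word_perm_permutes: "rs \<in> lists {1..<n} \<Longrightarrow> word_perm rs permutes {1..n}"
proof (induction rs)
  case (Cons r rs)
  then have "transpose r (Suc r) permutes {1..n}" by (intro permutes_swap_id) auto
  moreover have "word_perm rs permutes {1..n}" using Cons by simp
  ultimately show ?case unfolding word_perm_Cons by (intro permutes_compose)
qed (simp add: permutes_id)

lemma transpose_image_move:
  "r \<in> S \<Longrightarrow> Suc r \<notin> S \<Longrightarrow> transpose r (Suc r) ` S = insert (Suc r) (S - {r})"
  "r \<notin> S \<Longrightarrow> Suc r \<in> S \<Longrightarrow> transpose r (Suc r) ` S = insert r (S - {Suc r})"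
  by (auto simp: transpose_def image_iff split: if_splits)

text \<open>At every step exactly one of \<open>r\<close> and \<open>Suc r\<close> lies in the
  current set. So the transposition is increasing on this set and also on its complement.\<close>

lemma raising_word_perm:
  assumes "raising n {1..k} rs A" "k \<le> n"
  shows "word_perm rs ` {1..k} = A \<and> strict_mono_on {1..k} (word_perm rs) \<and>
    strict_mono_on {k + 1..n} (word_perm rs)"
  using assms
proof (induction rs arbitrary: A)
  case Nil
  then show ?case by (auto simp: strict_mono_on_def)
next
  case (Cons r rs)
  let ?B = "insert r (A - {Suc r})" and ?w = "word_perm rs"
  have raising: "raising n {1..k} rs ?B" using Cons by simp
  note IH = Cons.IH[OF raising Cons.prems(2)]
  have perm: "?w permutes {1..n}" using word_perm_permutes raising_lists[OF raising] by blast
  have "?w ` {k + 1..n} = ?w ` ({1..n} - {1..k})" by (rule arg_cong[where f = "image ?w"]) auto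
  also have "\<dots> = ?w ` {1..n} - ?w ` {1..k}"
    by (rule image_set_diff) (use permutes_inj[OF perm] in \<open>simp add: inj_def\<close>)
  also have "\<dots> = {1..n} - ?B" using permutes_image[OF perm] IH by simp
  finally have rest: "?w ` {k + 1..n} = {1..n} - ?B" .
  have "strict_mono_on (?w ` {1..k}) (transpose r (Suc r))"
    using IH Cons.prems by (intro strict_mono_on_transpose) auto
  moreover have "strict_mono_on (?w ` {k + 1..n}) (transpose r (Suc r))"
    unfolding rest using Cons.prems by (intro strict_mono_on_transpose) auto
  moreover have "transpose r (Suc r) ` ?B = A"
    using transpose_image_move(1)[of r ?B] Cons.prems by auto
  ultimately show ?case
    using IH unfolding word_perm_Cons image_comp[symmetric]
    by (intro conjI strict_mono_on_comp) simp_all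
qed

text \<open>Each letter of a word moves at most one entry of the image of \<open>{1..k}\<close>, and then by 1.
  Hence a word that attains the bound moves one entry raising in every step.\<close>

lemma sum_word_perm_le:
  assumes "rs \<in> lists {1..<n}"
  shows "\<Sum>(word_perm rs ` {1..k}) \<le> \<Sum>{1..k} + length rs \<and>
    (\<Sum>(word_perm rs ` {1..k}) = \<Sum>{1..k} + length rs \<longrightarrow> raising n {1..k} rs (word_perm rs ` {1..k}))"
  using assms
proof (induction rs)
  case (Cons r rs)
  let ?S = "word_perm rs ` {1..k}"
  have img: "word_perm (r # rs) ` {1..k} = transpose r (Suc r) ` ?S" by (simp add: image_comp)
  have IH: "\<Sum>?S \<le> \<Sum>{1..k} + length rs"
    "\<Sum>?S = \<Sum>{1..k} + length rs \<Longrightarrow> raising n {1..k} rs ?S" using Cons by auto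
  consider "r \<in> ?S \<longleftrightarrow> Suc r \<in> ?S" | "r \<in> ?S" "Suc r \<notin> ?S" | "r \<notin> ?S" "Suc r \<in> ?S" by blast
  then show ?case
  proof cases
    case 1
    then have "transpose r (Suc r) ` ?S = ?S" by (rule transpose_image_eq)
    then show ?thesis unfolding img using IH(1) by simp
  next
    case 2
    let ?T = "insert (Suc r) (?S - {r})"
    have "insert r (?T - {Suc r}) = ?S" using 2 by auto
    moreover from this have "\<Sum>?T = Suc (\<Sum>?S)" using sum_move[of ?T r] 2 by simp
    moreover have "r \<in> {1..<n}" using Cons by simp
    ultimately show ?thesis unfolding img transpose_image_move(1)[OF 2]
      using IH by simp
  next
    case 3
    have "\<Sum>?S = Suc (\<Sum>(insert r (?S - {Suc r})))" using sum_move[of ?S r] 3 by simp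
    then show ?thesis unfolding img transpose_image_move(2)[OF 3] using IH(1) by simp
  qed
qed simp

text \<open>By \<open>sum_word_perm_le\<close> every word of this permutation is at least as long as
  the increase of the sum, and a word that attains this bound is raising. The second part gives
  access to the word that \<open>SOME\<close> selects in \<open>specht_v\<close>.\<close>

lemma reduced_expression_raising:
  assumes "raising n {1..k} rs A" "k \<le> n"
  shows "reduced_expression n (word_perm rs) rs"
    and "reduced_expression n (word_perm rs) rs' \<Longrightarrow> raising n {1..k} rs' A"
proof -
  have img: "word_perm rs ` {1..k} = A" using raising_word_perm[OF assms] by simp
  have len: "\<Sum>A = \<Sum>{1..k} + length rs" using raising_sum[OF assms(1)] by simp
  show "reduced_expression n (word_perm rs) rs"
    unfolding reduced_expression_def
  proof (intro conjI ballI impI)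
    fix rs' assume rs': "rs' \<in> lists {1..<n}" "word_perm rs' = word_perm rs"
    then show "length rs \<le> length rs'"
      using sum_word_perm_le[OF rs'(1), of k] img len by simp
  qed (use raising_lists[OF assms(1)] in auto)
  assume "reduced_expression n (word_perm rs) rs'"
  then have rs': "rs' \<in> lists {1..<n}" "word_perm rs' = word_perm rs" "length rs' \<le> length rs"
    using raising_lists[OF assms(1)] by (auto simp: reduced_expression_def)
  show "raising n {1..k} rs' A"
    using sum_word_perm_le[OF rs'(1), of k] img len rs' by simp
qed

section \<open>Hook tableaux\<close>

lemma hook_cases:
  assumes "x \<in> hook a b" "0 < a"
  obtains r where "x = (r, 1)" "1 \<le> r" "r \<le> b + 1" | c where "x = (1, c)" "2 \<le> c" "c \<le> a"
  using assms by (force simp: hook_def hook_arm_def hook_leg_def)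

lemma hook_iff: "0 < a \<Longrightarrow>
    (r, c) \<in> hook a b \<longleftrightarrow> c = 1 \<and> 1 \<le> r \<and> r \<le> b + 1 \<or> r = 1 \<and> 2 \<le> c \<and> c \<le> a"
  by (auto simp: hook_def hook_arm_def hook_leg_def)

lemma initial_tableau_simps:
  "0 < a \<Longrightarrow> 1 \<le> r \<Longrightarrow> r \<le> b + 1 \<Longrightarrow> initial_tableau a b (r, Suc 0) = r"
  "0 < a \<Longrightarrow> 2 \<le> c \<Longrightarrow> c \<le> a \<Longrightarrow> initial_tableau a b (Suc 0, c) = b + c"
  by (auto simp: initial_tableau_def hook_iff)

lemma initial_tableau_bij: assumes "0 < a" shows "bij_betw (initial_tableau a b) (hook a b) {1..a + b}"
proof (rule bij_betw_byWitness[where f' = "\<lambda>k. if k \<le> b + 1 then (k, 1) else (1, k - b)"])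
  show "\<forall>x\<in>hook a b. (if initial_tableau a b x \<le> b + 1 then (initial_tableau a b x, 1)
      else (1, initial_tableau a b x - b)) = x"
    using assms by (auto elim!: hook_cases simp: initial_tableau_simps)
  show "initial_tableau a b ` hook a b \<subseteq> {1..a + b}"
    using assms by (auto elim!: hook_cases simp: initial_tableau_simps)
qed (use assms in \<open>auto simp: hook_iff initial_tableau_simps\<close>)

text \<open>The entry \<open>k\<close> has residue 1 - k in the first column and k - b - 1 in the
  arm, modulo 2. As \<open>b\<close> is even, the alternation continues from the bottom of the leg
  to the arm.\<close>

lemma initial_residues_eq:
  assumes "0 < a" "even b" shows "initial_residues a b = alt_seq (a + b)"
proof
  fix k
  show "initial_residues a b k = alt_seq (a + b) k"
  proof (cases "k \<in> {1..a + b}")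
    case True
    let ?x = "if k \<le> b + 1 then (k, 1) else (1, k - b)"
    have x: "?x \<in> hook a b" "initial_tableau a b ?x = k"
      using True assms by (auto simp: hook_iff initial_tableau_simps)
    have "the_inv_into (hook a b) (initial_tableau a b) k = ?x"
      using the_inv_into_f_eq[OF bij_betw_imp_inj_on[OF initial_tableau_bij[OF assms(1)]] x(2) x(1)] .
    then have "initial_residues a b k = residue ?x" using True by (simp add: initial_residues_def)
    also have "\<dots> = (if even k then 1 else 0)"
      using True assms(2) by (auto simp: residue_def of_nat_diff) presburger+
    finally show ?thesis using True by (simp add: alt_seq_def)
  qed (auto simp: initial_residues_def alt_seq_def)
qed

lemma standard_tableau_row:
    "standard_tableau a b T \<Longrightarrow> (r, c) \<in> hook a b \<Longrightarrow> (r, c') \<in> hook a b \<Longrightarrow> c < c' \<Longrightarrow> T (r, c) < T (r, c')"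
  and standard_tableau_column:
    "standard_tableau a b T \<Longrightarrow> (r, c) \<in> hook a b \<Longrightarrow> (r', c) \<in> hook a b \<Longrightarrow> r < r' \<Longrightarrow> T (r, c) < T (r', c)"
  by (simp_all add: standard_tableau_def)

lemma standard_tableau_corner:
  assumes T: "standard_tableau a b T" and a: "0 < a" shows "T (1, 1) = 1"
proof -
  have bij: "bij_betw T (hook a b) {1..a + b}" using T by (simp add: standard_tableau_def tableau_def)
  have "1 \<in> T ` hook a b" using bij a by (simp add: bij_betw_def)
  then obtain x where x: "x \<in> hook a b" "T x = 1" by auto
  have c: "(1, 1) \<in> hook a b" using a by (simp add: hook_iff)
  have ge: "1 \<le> T (1, 1)" using bspec[OF bij_betwE[OF bij] c] by simp
  show ?thesis
  proof (cases "x = (1, 1)")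
    case False
    have "T (1, 1) < T x"
      using x(1) a
    proof (cases rule: hook_cases)
      case (1 r)
      then have "1 < r" "(r, 1) \<in> hook a b" using False x(1) by auto
      then show ?thesis using standard_tableau_column[OF T c] 1 by simp
    next
      case (2 c')
      then have "1 < c'" "(1, c') \<in> hook a b" using x(1) by auto
      then show ?thesis using standard_tableau_row[OF T c] 2 by simp
    qed
    then show ?thesis using ge x by simp
  qed (use x in simp)
qed

lemma hook_split: "0 < a \<Longrightarrow> hook a b = insert (1, 1) (hook_leg b \<union> hook_arm a)"
  and hook_leg_image: "hook_leg b = (\<lambda>r. (r, 1)) ` {2..b + 1}"
  and hook_arm_image: "hook_arm a = (\<lambda>c. (1, c)) ` {2..a}"
  by (auto simp: hook_def hook_arm_def hook_leg_def)

text \<open>The corner entry is 1, the arm entries are the complement of the others, and the entries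
  of the leg and of the arm occur in increasing order. This makes \<open>THE\<close> in
  \<open>T_tableau\<close> meaningful.\<close>

lemma standard_tableau_unique:
  assumes T: "standard_tableau a b T" and T': "standard_tableau a b T'"
    and leg: "T ` hook_leg b = T' ` hook_leg b" and a: "0 < a"
  shows "T = T'"
proof -
  have bij: "bij_betw T (hook a b) {1..a + b}" "bij_betw T' (hook a b) {1..a + b}"
    using T T' by (auto simp: standard_tableau_def tableau_def)
  have arm_eq: "T'' ` hook_arm a = {1..a + b} - {1} - T'' ` hook_leg b" if "standard_tableau a b T''" for T''
  proof -
    have b: "bij_betw T'' (hook a b) {1..a + b}" using that by (simp add: standard_tableau_def tableau_def)
    have "hook_arm a = hook a b - {(1, 1)} - hook_leg b"
      by (auto simp: hook_def hook_arm_def hook_leg_def)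
    moreover have "{(1, 1)} \<subseteq> hook a b" "hook_leg b \<subseteq> hook a b" "hook_leg b \<subseteq> hook a b - {(1,1)}"
      by (auto simp: hook_def hook_leg_def)
    moreover have "hook a b - {(1, 1)} - hook_leg b \<subseteq> hook a b" by blast
    ultimately show ?thesis
      using b inj_on_image_set_diff[of T'' "hook a b" "hook a b - {(1,1)}" "hook_leg b"]
        inj_on_image_set_diff[of T'' "hook a b" "hook a b" "{(1,1)}"] standard_tableau_corner[OF that a]
      by (simp add: bij_betw_def)
  qed
  have leg_mono: "strict_mono_on {2..b + 1} (\<lambda>r. T'' (r, 1))" if "standard_tableau a b T''" for T''
    using that a by (auto simp: strict_mono_on_def standard_tableau_def hook_iff)
  have arm_mono: "strict_mono_on {2..a} (\<lambda>c. T'' (1, c))" if "standard_tableau a b T''" for T''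
    using that a by (auto simp: strict_mono_on_def standard_tableau_def hook_iff)
  have "T (r, 1) = T' (r, 1)" if "r \<in> {2..b + 1}" for r
    using strict_mono_on_image_unique[OF leg_mono[OF T] leg_mono[OF T'] _ that] leg
    by (simp add: hook_leg_image image_image)
  moreover have "T (1, c) = T' (1, c)" if "c \<in> {2..a}" for c
    using strict_mono_on_image_unique[OF arm_mono[OF T] arm_mono[OF T'] _ that] leg
      arm_eq[OF T] arm_eq[OF T']
    by (simp add: hook_arm_image image_image)
  ultimately have "T x = T' x" if "x \<in> hook a b" for x
    using that standard_tableau_corner[OF T a] standard_tableau_corner[OF T' a]
    by (auto simp: hook_split[OF a] hook_leg_image hook_arm_image)
  then show ?thesis
    using T T' by (auto simp: standard_tableau_def tableau_def intro: extensionalityI)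
qed

text \<open>\<open>A\<close> is the set of entries of the whole first column, corner included, hence
  \<open>1 \<in> A\<close>. The two intervals on which the permutation is increasing are the entries
  of the first column and of the arm of the initial tableau.\<close>

lemma raising_standard_tableau:
  assumes raising: "raising (a + b) {1..b + 1} rs A" and A: "1 \<in> A" and a: "0 < a"
  defines "T \<equiv> restrict (word_perm rs \<circ> initial_tableau a b) (hook a b)"
  shows "standard_tableau a b T" and "T ` hook_leg b = A - {1}" and "tableau_perm a b T = word_perm rs"
proof -
  let ?w = "word_perm rs" and ?T0 = "initial_tableau a b"
  have w: "?w ` {1..b + 1} = A" "strict_mono_on {1..b + 1} ?w" "strict_mono_on {b + 2..a + b} ?w"
    using raising_word_perm[OF raising] a by auto
  have perm: "?w permutes {1..a + b}" using word_perm_permutes raising_lists[OF raising] by blast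
  then have bij: "bij_betw ?w {1..a + b} {1..a + b}" by (rule permutes_imp_bij)
  have w1: "?w 1 = 1"
  proof -
    obtain x where x: "x \<in> {1..b + 1}" "?w x = 1" using A w(1) by force
    show ?thesis
    proof (cases "x = 1")
      case False
      then have "?w 1 < ?w x" using strict_mono_onD[OF w(2), of 1 x] x by simp
      moreover have "1 \<le> ?w 1" using bij_betwE[OF bij] a by force
      ultimately show ?thesis using x by simp
    qed (use x in simp)
  qed
  have T_leg: "T (r, 1) = ?w r" if "1 \<le> r" "r \<le> b + 1" for r
    using that a by (simp add: T_def hook_iff initial_tableau_simps)
  have T_arm: "T (1, c) = ?w (b + c)" if "2 \<le> c" "c \<le> a" for c
    using that a by (simp add: T_def hook_iff initial_tableau_simps)
  have "bij_betw (?w \<circ> ?T0) (hook a b) {1..a + b}"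
    using bij_betw_trans[OF initial_tableau_bij[OF a] bij] .
  then have tab: "tableau a b T"
    by (simp add: tableau_def T_def bij_betw_restrict_eq)
  have "T (r, c) < T (r, c')" if h: "(r, c) \<in> hook a b" "(r, c') \<in> hook a b" "c < c'" for r c c'
  proof -
    have r: "r = 1" "2 \<le> c'" "c' \<le> a" using h a by (auto simp: hook_iff)
    show ?thesis
    proof (cases "c = 1")
      case True
      have "?w (b + c') \<noteq> ?w 1" using permutes_inj[OF perm] r by (simp add: inj_eq)
      moreover have "1 \<le> ?w (b + c')" using bij_betwE[OF bij] r by force
      ultimately show ?thesis using True r T_leg[of 1] T_arm[of c'] w1 by simp
    next
      case False
      then have "2 \<le> c" using h a by (auto simp: hook_iff)
      then show ?thesis using r h(3) T_arm[of c] T_arm[of c'] w(3) by (simp add: strict_mono_on_def)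
    qed
  qed
  moreover have "T (r, c) < T (r', c)" if h: "(r, c) \<in> hook a b" "(r', c) \<in> hook a b" "r < r'" for r r' c
  proof -
    have "c = 1" "1 \<le> r" "r' \<le> b + 1" using h a by (auto simp: hook_iff)
    then show ?thesis using h(3) T_leg[of r] T_leg[of r'] w(2) by (simp add: strict_mono_on_def)
  qed
  ultimately show "standard_tableau a b T" using tab by (auto simp: standard_tableau_def)
  have "T ` hook_leg b = ?w ` {2..b + 1}"
    unfolding hook_leg_image image_image by (rule image_cong) (auto simp: T_leg[simplified])
  also have "{2..b + 1} = {1..b + 1} - {1}" by auto
  also have "?w ` \<dots> = A - {1}"
    using image_set_diff[OF permutes_inj[OF perm], of "{1..b + 1}" "{1}"] w(1) w1 by simp
  finally show "T ` hook_leg b = A - {1}" .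
  show "tableau_perm a b T = ?w"
    unfolding tableau_perm_def
  proof (rule the_equality)
    show "?w permutes {1..a + b} \<and> (\<forall>x\<in>hook a b. ?w (?T0 x) = T x)"
      using perm by (simp add: T_def)
    fix v assume v: "v permutes {1..a + b} \<and> (\<forall>x\<in>hook a b. v (?T0 x) = T x)"
    show "v = ?w"
    proof
      fix y show "v y = ?w y"
      proof (cases "y \<in> {1..a + b}")
        case True
        then have "y \<in> ?T0 ` hook a b" using initial_tableau_bij[OF a, of b] by (simp add: bij_betw_def)
        then obtain x where "x \<in> hook a b" "y = ?T0 x" by blast
        then show ?thesis using v by (auto simp: T_def)
      next
        case False
        then show ?thesis using v perm by (auto simp: permutes_def)
      qed
    qed
  qed
qed

lemma raising_subset_card:
  assumes "raising n {1..k} rs A" "k \<le> n" shows "A \<subseteq> {1..n}" "card A = k"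
proof -
  have perm: "word_perm rs permutes {1..n}" using word_perm_permutes raising_lists[OF assms(1)] by blast
  have A: "A = word_perm rs ` {1..k}" using raising_word_perm[OF assms] by simp
  show "A \<subseteq> {1..n}"
    unfolding A using permutes_image[OF perm] assms(2) image_mono[of "{1..k}" "{1..n}" "word_perm rs"] by simp
  show "card A = k"
    unfolding A using card_image[OF inj_on_subset[OF permutes_inj[OF perm]], of "{1..k}"] by simp
qed

text \<open>Both choices are resolved here: \<open>THE\<close> in \<open>T_tableau\<close> by
  exhibiting the tableau of a raising word, and \<open>SOME\<close> by the fact that all reduced
  words of its permutation are raising.\<close>

lemma T_tableau_reduced:
  assumes raising: "raising (a + b) {1..b + 1} rs A" and a: "0 < a"
    and A: "1 \<in> A" "A - {1} = ({2..b + 1} - {i - 1, i}) \<union> {j - 1, j}"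
  defines "rs' \<equiv> SOME rs. reduced_expression (a + b) (tableau_perm a b (T_tableau a b i j)) rs"
  shows "raising (a + b) {1..b + 1} rs' A"
proof -
  let ?T = "restrict (word_perm rs \<circ> initial_tableau a b) (hook a b)"
  note T = raising_standard_tableau[OF raising A(1) a]
  have "T_tableau a b i j = ?T"
    unfolding T_tableau_def
  proof (rule the_equality)
    show "standard_tableau a b ?T \<and> ?T ` hook_leg b = ({2..b + 1} - {i - 1, i}) \<union> {j - 1, j}"
      by (rule conjI[OF T(1) trans[OF T(2) A(2)]])
    show "T' = ?T" if "standard_tableau a b T' \<and>
        T' ` hook_leg b = ({2..b + 1} - {i - 1, i}) \<union> {j - 1, j}" for T'
      using that T(2) A(2) by (intro standard_tableau_unique[OF _ T(1) _ a]) simp_all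
  qed
  then have "rs' = (SOME rs'. reduced_expression (a + b) (word_perm rs) rs')"
    using T(3) by (simp add: rs'_def)
  moreover have "reduced_expression (a + b) (word_perm rs) (SOME rs'. reduced_expression (a + b) (word_perm rs) rs')"
    using reduced_expression_raising(1)[OF raising] a by (intro someI) auto
  ultimately show ?thesis using reduced_expression_raising(2)[OF raising] a by simp
qed

section \<open>Raising words for the moves of dominoes\<close>

lemma dswap_word_raising:
  assumes "raising n A0 rs A" "1 \<le> r" "r + 3 \<le> n" "r \<in> A" "r + 1 \<in> A" "r + 2 \<notin> A" "r + 3 \<notin> A"
  shows "raising n A0 (dswap_word r @ rs) (A - {r, r + 1} \<union> {r + 2, r + 3})"
proof -
  let ?A1 = "A - {r, r + 1} \<union> {r + 2, r + 3}"
  \<comment> \<open>\<open>raising\<close> undoes the letters beginning with the leftmost one; the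
    left side is the set obtained after all four.\<close>
  have eq: "insert (r + 1) (insert (r + 2) (insert r (insert (r + 1) (?A1 - {r + 2}) - {r + 1}) - {r + 3}) - {r + 2}) = A"
  proof (rule Set.set_eqI)
    fix x show "x \<in> insert (r + 1) (insert (r + 2) (insert r (insert (r + 1) (?A1 - {r + 2}) - {r + 1}) - {r + 3}) - {r + 2})
        \<longleftrightarrow> x \<in> A"
      by (cases "x = r"; cases "x = r + 1"; cases "x = r + 2"; cases "x = r + 3") (use assms in simp_all)
  qed
  show ?thesis
    using assms eq by (simp add: dswap_word_def numeral_eq_Suc)
qed

lemma right_word_raising:
  assumes "m + t \<le> N" "0 < m"
  shows "raising (2 * N + 1) {1..2 * m + 1} (right_word m t) ({1..2 * m - 1} \<union> {2 * (m + t), 2 * (m + t) + 1})"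
  using assms(1)
proof (induction t)
  case 0
  then show ?case using assms(2) by auto
next
  case (Suc t)
  let ?A = "{1..2 * m - 1} \<union> {2 * (m + t), 2 * (m + t) + 1}"
  have "raising (2 * N + 1) {1..2 * m + 1} (dswap_word (2 * (m + t)) @ right_word m t)
      (?A - {2 * (m + t), 2 * (m + t) + 1} \<union> {2 * (m + t) + 2, 2 * (m + t) + 3})"
    by (rule dswap_word_raising) (use Suc assms(2) in auto)
  also have "?A - {2 * (m + t), 2 * (m + t) + 1} \<union> {2 * (m + t) + 2, 2 * (m + t) + 3}
      = {1..2 * m - 1} \<union> {2 * (m + Suc t), 2 * (m + Suc t) + 1}" using assms(2) by auto
  finally show ?case by simp
qed

text \<open>Moving an arm domino one place to the left moves the leg domino at
  \<open>m - 1 - s\<close> one place to the right. So the left words raise the set as well.\<close>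

lemma left_word_raising:
  assumes "m + t < N" "s < m"
  shows "raising (2 * N + 1) {1..2 * m + 1} (left_word m s @ right_word m (Suc t))
    ({1..2 * m + 1} - {2 * (m - s), 2 * (m - s) + 1} \<union> {2 * (m + Suc t), 2 * (m + Suc t) + 1})"
  using assms(2)
proof (induction s)
  case 0
  have "{1..2 * m + 1} - {2 * m, 2 * m + 1} = {1..2 * m - 1}" by auto
  then show ?case using right_word_raising[of m "Suc t" N] assms 0 by simp
next
  case (Suc s)
  let ?A = "{1..2 * m + 1} - {2 * (m - s), 2 * (m - s) + 1} \<union> {2 * (m + Suc t), 2 * (m + Suc t) + 1}"
  define r where "r = m - 1 - s"
  have r: "0 < r" "m - s = r + 1" "m - Suc s = r" "r < m" using Suc by (auto simp: r_def)
  have "raising (2 * N + 1) {1..2 * m + 1} (dswap_word (2 * r) @ left_word m s @ right_word m (Suc t))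
      (?A - {2 * r, 2 * r + 1} \<union> {2 * r + 2, 2 * r + 3})"
    by (rule dswap_word_raising) (use Suc assms r in auto)
  also have "?A - {2 * r, 2 * r + 1} \<union> {2 * r + 2, 2 * r + 3} =
     {1..2 * m + 1} - {2 * (m - Suc s), 2 * (m - Suc s) + 1} \<union> {2 * (m + Suc t), 2 * (m + Suc t) + 1}"
    unfolding r using r(1,4) by auto
  finally show ?case by (simp add: r_def)
qed

section \<open>The free algebra and its quotients\<close>

text \<open>The range of the projection is a copy of the quotient by \<open>J\<close> inside a type of class \<open>ring_1\<close>, so that
  computations in the quotient need no cosets.\<close>

lemma exists_additive_projection:
  fixes J :: "('x::monoid_add \<Rightarrow>\<^sub>0 'a::field) set"
  assumes zero: "0 \<in> J" and add: "\<And>x y. x \<in> J \<Longrightarrow> y \<in> J \<Longrightarrow> x + y \<in> J"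
    and scale: "\<And>c x. x \<in> J \<Longrightarrow> Poly_Mapping.single 0 c * x \<in> J"
  obtains p :: "('x \<Rightarrow>\<^sub>0 'a) \<Rightarrow> ('x \<Rightarrow>\<^sub>0 'a)"
  where "\<And>x y. p (x + y) = p x + p y" and "\<And>x. x - p x \<in> J" and "\<And>x. x \<in> J \<Longrightarrow> p x = 0"
proof -
  define sc where "sc c x = Poly_Mapping.single 0 c * x" for c :: 'a and x :: "'x \<Rightarrow>\<^sub>0 'a"
  interpret vector_space sc
    by unfold_locales
      (simp_all add: sc_def algebra_simps single_add mult_single mult.assoc[symmetric])
  interpret vector_space_pair sc sc by unfold_locales
  have J: "subspace J" using assms by (simp add: subspace_def sc_def)
  obtain B where B: "B \<subseteq> J" "independent B" "J \<subseteq> span B"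
    using maximal_independent_subset[of J] by blast
  let ?B = "extend_basis B"
  have B': "independent ?B" "span ?B = UNIV" "B \<subseteq> ?B"
    using independent_extend_basis span_extend_basis extend_basis_superset B(2) by auto
  define p where "p = construct ?B (\<lambda>b. if b \<in> B then 0 else b)"
  have lin: "Vector_Spaces.linear sc sc p"
    unfolding p_def by (rule linear_construct[OF B'(1)])
  have pB: "p b = (if b \<in> B then 0 else b)" if "b \<in> ?B" for b
    unfolding p_def using construct_basis[OF B'(1) that] .
  have lin': "Vector_Spaces.linear sc sc (\<lambda>x. x - p x)"
    using linear_compose_sub[OF linear_ident lin] .
  show thesis
  proof
    show "p (x + y) = p x + p y" for x y using linear_add[OF lin] .
    show "p x = 0" if "x \<in> J" for x
    proof (rule linear_eq_0_on_span[OF lin])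
      show "x \<in> span B" using that B(3) by blast
    qed (use pB B'(3) in auto)
    show "x - p x \<in> J" for x
    proof -
      \<comment> \<open>On the extended basis \<open>x - p x\<close> is the identity at members of
        \<open>B\<close> and 0 at the added vectors.\<close>
      have "(\<lambda>x. x - p x) ` span ?B = span ((\<lambda>x. x - p x) ` ?B)"
        using linear_span_image[OF lin'] by simp
      also have "\<dots> \<subseteq> J"
        by (rule span_minimal[OF _ J]) (use pB B(1) zero in auto)
      finally show ?thesis using B'(2) by blast
    qed
  qed
qed

section \<open>Arithmetic in the free algebra\<close>

lemma free_algebra_simps [simp]:
  "x \<otimes>\<^bsub>free_algebra G\<^esub> y = x * y" "x \<oplus>\<^bsub>free_algebra G\<^esub> y = x + y"
  "\<one>\<^bsub>free_algebra G\<^esub> = 1" "\<zero>\<^bsub>free_algebra G\<^esub> = 0"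
  by (simp_all add: free_algebra_def)

lemma free_algebra_uminus [simp]:
  assumes "x \<in> carrier (free_algebra G)" shows "\<ominus>\<^bsub>free_algebra G\<^esub> x = - x"
proof -
  interpret ring "free_algebra G" by (rule ring_free_algebra)
  have "- x \<in> carrier (free_algebra G)" using assms by (simp add: free_algebra_def)
  then show ?thesis using minus_equality[of "- x" x] assms by simp
qed

lemma free_algebra_closed [simp, intro]:
  fixes x y :: "'x free_monoid \<Rightarrow>\<^sub>0 'a::field"
  assumes "x \<in> carrier (free_algebra G)"
  shows "y \<in> carrier (free_algebra G) \<Longrightarrow> x + y \<in> carrier (free_algebra G)"
    "y \<in> carrier (free_algebra G) \<Longrightarrow> x - y \<in> carrier (free_algebra G)"
    "y \<in> carrier (free_algebra G) \<Longrightarrow> x * y \<in> carrier (free_algebra G)"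
    "- x \<in> carrier (free_algebra G)"
proof -
  interpret ring "free_algebra G :: ('x free_monoid \<Rightarrow>\<^sub>0 'a) ring" by (rule ring_free_algebra)
  show neg: "- x \<in> carrier (free_algebra G)" using assms a_inv_closed[OF assms] by simp
  assume y: "y \<in> carrier (free_algebra G)"
  show "x + y \<in> carrier (free_algebra G)" "x * y \<in> carrier (free_algebra G)"
    using a_closed[OF assms y] m_closed[OF assms y] by simp_all
  show "x - y \<in> carrier (free_algebra G)" using minus_closed[OF assms y] y by (simp add: a_minus_def)
qed

lemma free_algebra_const [simp]: "Poly_Mapping.single 0 c \<in> carrier (free_algebra G)"
  by (auto simp: free_algebra_def zero_free_monoid_def)

lemma free_algebra_0_1 [simp]: "0 \<in> carrier (free_algebra G)" "1 \<in> carrier (free_algebra G)"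
  using free_algebra_const[of 0 G] free_algebra_const[of 1 G] by simp_all

lemma free_algebra_power [simp]: "x \<in> carrier (free_algebra G) \<Longrightarrow> x ^ k \<in> carrier (free_algebra G)"
  by (induction k) simp_all

lemma free_algebra_sum [simp]:
  "(\<And>i. i \<in> I \<Longrightarrow> f i \<in> carrier (free_algebra G)) \<Longrightarrow> sum f I \<in> carrier (free_algebra G)"
  by (induction I rule: infinite_finite_induct) simp_all

lemma of_nat_eq_single: "(of_nat c :: 'x::monoid_add \<Rightarrow>\<^sub>0 'a::field) = Poly_Mapping.single 0 (of_nat c)"
  by (induction c) (simp_all add: single_add)

lemma free_algebra_of_nat [simp]: "of_nat c \<in> carrier (free_algebra G)" "numeral k \<in> carrier (free_algebra G)"
  using free_algebra_const[of "of_nat c" G] free_algebra_const[of "of_nat (numeral k)" G]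
  unfolding of_nat_eq_single[symmetric] by simp_all

abbreviation klr_carrier :: "nat \<Rightarrow> 'a::field klr_free set" where
  "klr_carrier n \<equiv> carrier (free_algebra (klr_gens n))"

lemma free_gens_in_carrier [simp]:
  "r \<in> {1..n} \<Longrightarrow> free_y r \<in> klr_carrier n"
  "r \<in> {1..<n} \<Longrightarrow> free_psi r \<in> klr_carrier n"
  "i \<in> residue_seqs n \<Longrightarrow> free_e i \<in> klr_carrier n"
  by (auto simp: free_y_def free_psi_def free_e_def free_algebra_def klr_gens_def)

lemma swap_seq_residue_seqs [simp]: "i \<in> residue_seqs n \<Longrightarrow> r \<in> {1..<n} \<Longrightarrow> swap_seq r i \<in> residue_seqs n"
  by (auto simp: residue_seqs_def swap_seq_def PiE_iff extensional_def transpose_def)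

lemma klr_relations_carrier:
  assumes "0 < n"
  shows "klr_relations n \<subseteq> klr_carrier n"
  unfolding klr_relations_def Let_def using assms
  by (intro Un_least) auto

lemma hecke_ideal_ideal:
  assumes "0 < n" shows "ideal (hecke_ideal n) (free_algebra (klr_gens n))"
proof -
  interpret ring "free_algebra (klr_gens n)" by (rule ring_free_algebra)
  show ?thesis unfolding hecke_ideal_def by (rule genideal_ideal[OF klr_relations_carrier[OF assms]])
qed

lemma klr_relations_hecke_ideal:
  assumes "0 < n" shows "klr_relations n \<subseteq> hecke_ideal n"
proof -
  interpret ring "free_algebra (klr_gens n)" by (rule ring_free_algebra)
  show ?thesis unfolding hecke_ideal_def by (rule genideal_self[OF klr_relations_carrier[OF assms]])
qed

section \<open>Generated left ideals and quotient modules\<close>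

lemma left_ideal_gen:
  assumes "ring R" and S: "S \<subseteq> carrier R"
  shows left_ideal_left_ideal_gen: "left_ideal R (left_ideal_gen R S)"
    and left_ideal_gen_superset: "S \<subseteq> left_ideal_gen R S"
proof -
  interpret ring R by fact
  \<comment> \<open>The ring itself belongs to the family, so the intersection is over a nonempty
    family.\<close>
  have carr: "left_ideal R (carrier R)"
    by (auto simp: left_ideal_def intro!: additive_subgroup.intro add.subgroup_self)
  have "subgroup (left_ideal_gen R S) (add_monoid R)"
    unfolding left_ideal_gen_def
    by (rule add.subgroups_Inter) (use carr S in \<open>auto simp: left_ideal_def dest: additive_subgroup.a_subgroup\<close>)
  then show "left_ideal R (left_ideal_gen R S)"
    by (auto simp: left_ideal_def left_ideal_gen_def intro: additive_subgroup.intro)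
  show "S \<subseteq> left_ideal_gen R S" by (auto simp: left_ideal_gen_def)
qed

lemma left_ideal_gen_minimal: "left_ideal R J \<Longrightarrow> S \<subseteq> J \<Longrightarrow> left_ideal_gen R S \<subseteq> J"
  by (auto simp: left_ideal_gen_def)

context
  fixes R (structure) and J
  assumes R: "ring R" and J: "left_ideal R J"
begin

interpretation ring R by (rule R)
interpretation abelian_subgroup J R
  using J by (intro abelian_subgroupI3) (auto simp: left_ideal_def is_abelian_group)

lemma left_quotient_carrier: "carrier (left_quotient R J) = (\<lambda>x. J +> x) ` carrier R"
  by (auto simp: left_quotient_def A_RCOSETS_def')

lemma left_quotient_add:
  "x \<in> carrier R \<Longrightarrow> y \<in> carrier R \<Longrightarrow>
    (J +> x) \<oplus>\<^bsub>left_quotient R J\<^esub> (J +> y) = J +> (x \<oplus> y)"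
  by (simp add: left_quotient_def a_rcos_sum)

lemma left_quotient_eq_iff:
  assumes "x \<in> carrier R" "y \<in> carrier R" shows "J +> x = J +> y \<longleftrightarrow> x \<ominus> y \<in> J"
proof -
  have "x \<ominus> y \<in> J \<longleftrightarrow> x \<in> J +> y" using a_rcos_module[OF assms(2,1)] by (simp add: a_minus_def)
  also have "\<dots> \<longleftrightarrow> J +> x = J +> y"
    using a_rcos_self[OF assms(1)] a_repr_independence'[of x y] assms(2) by metis
  finally show ?thesis by simp
qed

text \<open>The union in \<open>left_quotient\<close> runs over all representatives. Two of them
  differ by an element of \<open>J\<close>, which \<open>r\<close> sends to \<open>J\<close> again,
  so all members of the union are the same coset.\<close>

lemma left_quotient_smult:
  assumes r: "r \<in> carrier R" and x: "x \<in> carrier R"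
  shows "r \<odot>\<^bsub>left_quotient R J\<^esub> (J +> x) = J +> (r \<otimes> x)"
proof -
  have "J +> (r \<otimes> y) = J +> (r \<otimes> x)" if "y \<in> J +> x" for y
  proof -
    have y: "y \<in> carrier R" using that a_elemrcos_carrier x by blast
    then have "y \<ominus> x \<in> J" using that a_rcos_module[of x y] x by (simp add: a_minus_def)
    then have "r \<otimes> (y \<ominus> x) \<in> J" using J r by (simp add: left_ideal_def)
    then show ?thesis using r x y
      by (subst left_quotient_eq_iff) (simp_all add: a_minus_def r_distr r_minus)
  qed
  moreover have "x \<in> J +> x" using a_rcos_self x by blast
  ultimately have "(\<Union>y\<in>J +> x. J +> (r \<otimes> y)) = J +> (r \<otimes> x)" by blast
  then show ?thesis by (simp add: left_quotient_def)
qed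

lemma left_quotient_abelian_group: "abelian_group (left_quotient R J)"
proof -
  let ?Q = "left_quotient R J"
  have zero: "\<zero>\<^bsub>?Q\<^esub> = J +> \<zero>" by (simp add: left_quotient_def a_subset)
  have rep: "\<exists>v\<in>carrier R. x = J +> v" if "x \<in> carrier ?Q" for x
    using that unfolding left_quotient_carrier by blast
  have closed: "J +> v \<in> carrier ?Q" if "v \<in> carrier R" for v
    using that unfolding left_quotient_carrier by blast
  show ?thesis
  proof (rule abelian_groupI)
    fix x y w assume "x \<in> carrier ?Q" "y \<in> carrier ?Q" "w \<in> carrier ?Q"
    then obtain x' y' w' where *: "x' \<in> carrier R" "y' \<in> carrier R" "w' \<in> carrier R"
      "x = J +> x'" "y = J +> y'" "w = J +> w'" using rep by meson
    show "x \<oplus>\<^bsub>?Q\<^esub> y \<in> carrier ?Q" using * by (simp add: left_quotient_add closed)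
    show "x \<oplus>\<^bsub>?Q\<^esub> y \<oplus>\<^bsub>?Q\<^esub> w = x \<oplus>\<^bsub>?Q\<^esub> (y \<oplus>\<^bsub>?Q\<^esub> w)"
      using * by (simp add: left_quotient_add a_assoc)
    show "x \<oplus>\<^bsub>?Q\<^esub> y = y \<oplus>\<^bsub>?Q\<^esub> x" using * by (simp add: left_quotient_add a_comm)
  next
    fix x assume "x \<in> carrier ?Q"
    then obtain x' where *: "x' \<in> carrier R" "x = J +> x'" using rep by meson
    show "\<zero>\<^bsub>?Q\<^esub> \<oplus>\<^bsub>?Q\<^esub> x = x" unfolding zero *(2) using * by (simp add: left_quotient_add del: a_coset_add_zero)
    have "(J +> \<ominus> x') \<oplus>\<^bsub>?Q\<^esub> x = \<zero>\<^bsub>?Q\<^esub>"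
      unfolding zero *(2) using * by (simp add: left_quotient_add l_neg del: a_coset_add_zero)
    then show "\<exists>y\<in>carrier ?Q. y \<oplus>\<^bsub>?Q\<^esub> x = \<zero>\<^bsub>?Q\<^esub>" using closed * by blast
  qed (use zero closed in simp)
qed

end

definition specht_class :: "nat \<Rightarrow> nat \<Rightarrow> 'a::field klr_free \<Rightarrow> 'a specht" where
  "specht_class a b p = specht_ideal a b +>\<^bsub>hecke_algebra (a + b)\<^esub> hecke_class (a + b) p"

text \<open>This is the kernel of the map p -> p z from the free algebra onto the Specht module. It
  merges the two successive quotients into one.\<close>

definition specht_kernel :: "nat \<Rightarrow> nat \<Rightarrow> 'a::field klr_free set" where
  "specht_kernel a b = {p \<in> klr_carrier (a + b). hecke_class (a + b) p \<in> specht_ideal a b}"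

lemma prod_list_closed [simp]:
  "(\<And>x. x \<in> set xs \<Longrightarrow> x \<in> carrier (free_algebra G)) \<Longrightarrow> prod_list xs \<in> carrier (free_algebra G)"
  by (induction xs) simp_all

section \<open>The Hecke algebra as a quotient of the free algebra\<close>

context
  fixes n :: nat
  assumes n: "0 < n"
begin

lemma ring_hecke_algebra: "ring (hecke_algebra n)"
  unfolding hecke_algebra_def by (rule ideal.quotient_is_ring[OF hecke_ideal_ideal[OF n]])

lemma hecke_class_hom: "(hecke_class n :: 'a::field klr_free \<Rightarrow> _) \<in> ring_hom (free_algebra (klr_gens n)) (hecke_algebra n)"
proof -
  have "(hecke_class n :: 'a klr_free \<Rightarrow> _) = (+>\<^bsub>free_algebra (klr_gens n)\<^esub>) (hecke_ideal n)"
    by (simp add: hecke_class_def fun_eq_iff)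
  then show ?thesis unfolding hecke_algebra_def
    using ideal.rcos_ring_hom[OF hecke_ideal_ideal[OF n]] by simp
qed

lemma hecke_class_simps:
  assumes p: "p \<in> klr_carrier n"
  shows "hecke_class n p \<in> carrier (hecke_algebra n)"
    "q \<in> klr_carrier n \<Longrightarrow> hecke_class n (p * q) = hecke_class n p \<otimes>\<^bsub>hecke_algebra n\<^esub> hecke_class n q"
    "q \<in> klr_carrier n \<Longrightarrow> hecke_class n (p + q) = hecke_class n p \<oplus>\<^bsub>hecke_algebra n\<^esub> hecke_class n q"
    "q \<in> klr_carrier n \<Longrightarrow> hecke_class n (p - q) = hecke_class n p \<ominus>\<^bsub>hecke_algebra n\<^esub> hecke_class n q"
proof -
  interpret h: ring_hom_ring "free_algebra (klr_gens n)" "hecke_algebra n" "hecke_class n"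
    by (rule ring_hom_ringI2[OF ring_free_algebra ring_hecke_algebra hecke_class_hom])
  show "hecke_class n p \<in> carrier (hecke_algebra n)" using p by simp
  assume q: "q \<in> klr_carrier n"
  show "hecke_class n (p * q) = hecke_class n p \<otimes>\<^bsub>hecke_algebra n\<^esub> hecke_class n q"
    using h.hom_mult[OF p q] by simp
  show "hecke_class n (p + q) = hecke_class n p \<oplus>\<^bsub>hecke_algebra n\<^esub> hecke_class n q"
    using h.hom_add[OF p q] by simp
  have "hecke_class n (p + - q) = hecke_class n p \<ominus>\<^bsub>hecke_algebra n\<^esub> hecke_class n q"
    using h.hom_add[of p "- q"] h.hom_a_inv[OF q] p q by (simp add: a_minus_def)
  then show "hecke_class n (p - q) = hecke_class n p \<ominus>\<^bsub>hecke_algebra n\<^esub> hecke_class n q" by simp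
qed

lemma hecke_class_0_1:
  "hecke_class n 0 = \<zero>\<^bsub>hecke_algebra n\<^esub>" "hecke_class n 1 = \<one>\<^bsub>hecke_algebra n\<^esub>"
proof -
  interpret h: ring_hom_ring "free_algebra (klr_gens n)" "hecke_algebra n" "hecke_class n"
    by (rule ring_hom_ringI2[OF ring_free_algebra ring_hecke_algebra hecke_class_hom])
  show "hecke_class n 0 = \<zero>\<^bsub>hecke_algebra n\<^esub>" "hecke_class n 1 = \<one>\<^bsub>hecke_algebra n\<^esub>"
    using h.hom_zero h.hom_one by simp_all
qed

lemma hecke_class_surj: "carrier (hecke_algebra n) = hecke_class n ` klr_carrier n"
  unfolding hecke_algebra_def FactRing_def A_RCOSETS_def' hecke_class_def
  by (simp only: partial_object.select_convs) blast

lemma hecke_class_eq_iff: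
  fixes p q :: "'a::field klr_free"
  shows "p \<in> klr_carrier n \<Longrightarrow> q \<in> klr_carrier n \<Longrightarrow> hecke_class n p = hecke_class n q \<longleftrightarrow> p - q \<in> hecke_ideal n"
  unfolding hecke_class_def
proof -
  assume pq: "p \<in> klr_carrier n" "q \<in> klr_carrier n"
  interpret ideal "hecke_ideal n :: 'a klr_free set" "free_algebra (klr_gens n)"
    by (rule hecke_ideal_ideal[OF n])
  have "left_ideal (free_algebra (klr_gens n)) (hecke_ideal n :: 'a klr_free set)"
    using I_l_closed additive_subgroup_axioms by (simp add: left_ideal_def)
  from left_quotient_eq_iff[OF ring_free_algebra this pq] pq
  show "hecke_ideal n +>\<^bsub>free_algebra (klr_gens n)\<^esub> p = hecke_ideal n +>\<^bsub>free_algebra (klr_gens n)\<^esub> q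
      \<longleftrightarrow> p - q \<in> hecke_ideal n"
    by (simp add: a_minus_def)
qed

lemma hecke_class_prod_list:
  "(\<And>x. x \<in> set xs \<Longrightarrow> x \<in> klr_carrier n) \<Longrightarrow> hecke_class n (prod_list xs) =
    foldr (\<lambda>x h. hecke_class n x \<otimes>\<^bsub>hecke_algebra n\<^esub> h) xs \<one>\<^bsub>hecke_algebra n\<^esub>"
proof (induction xs)
  case (Cons x xs)
  then have "x \<in> klr_carrier n" "prod_list xs \<in> klr_carrier n" by simp_all
  then show ?case using Cons hecke_class_simps(2)[of x "prod_list xs"] by simp
qed (simp add: hecke_class_0_1)

end

text \<open>\<open>p\<close> selects a representative in each class modulo \<open>J\<close>,
  additively; \<open>p x = p y\<close> expresses congruence modulo \<open>J\<close>. Elements of the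
  quotient module become fixed points of \<open>p\<close>, with \<open>p\<close> applied after each
  multiplication.\<close>

locale left_ideal_projection =
  fixes n :: nat and J :: "'a::field klr_free set" and p :: "'a klr_free \<Rightarrow> 'a klr_free"
  assumes n: "0 < n"
    and J_carrier: "J \<subseteq> klr_carrier n"
    and J_ideal: "hecke_ideal n \<subseteq> J"
    and J_add: "x \<in> J \<Longrightarrow> y \<in> J \<Longrightarrow> x + y \<in> J"
    and J_mult: "x \<in> J \<Longrightarrow> r \<in> klr_carrier n \<Longrightarrow> r * x \<in> J"
    and p_add: "p (x + y) = p x + p y"
    and p_diff_J: "x - p x \<in> J"
    and p_J: "x \<in> J \<Longrightarrow> p x = 0"
begin

lemma p_zero [simp]: "p 0 = 0"
  using p_add[of 0 0] by simp

lemma p_minus: "p (- x) = - p x"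
  using p_add[of x "- x"] by (simp add: eq_neg_iff_add_eq_0 add.commute)

lemma p_diff: "p (x - y) = p x - p y"
  using p_add[of x "- y"] by (simp add: p_minus)

lemma p_of_nat: "p (of_nat c * x) = of_nat c * p x"
  by (induction c) (simp_all add: distrib_right p_add)

lemma p_sum: "p (sum f I) = (\<Sum>i\<in>I. p (f i))"
  by (induction I rule: infinite_finite_induct) (simp_all add: p_add)

lemma p_eq_0_iff: "p x = 0 \<longleftrightarrow> x \<in> J"
  using p_J p_diff_J[of x] by auto

lemma p_eq_iff: "p x = p y \<longleftrightarrow> x - y \<in> J"
  using p_eq_0_iff[of "x - y"] by (simp add: p_diff)

lemma p_idem [simp]: "p (p x) = p x"
  using p_eq_iff[of x "p x"] p_diff_J[of x] by simp

lemma p_mult [simp]: "r \<in> klr_carrier n \<Longrightarrow> p (r * p x) = p (r * x)"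
  using J_mult[OF p_diff_J[of x], of r] p_eq_iff[of "r * x" "r * p x"]
  by (simp add: right_diff_distrib)

lemma p_carrier: "x \<in> klr_carrier n \<Longrightarrow> p x \<in> klr_carrier n"
  using p_diff_J[of x] J_carrier free_algebra_closed(2)[of x _ "x - p x"] by auto

text \<open>A relation has to be multiplied by \<open>x\<close> from the right, which the left ideal
  \<open>J\<close> need not allow; the two-sided ideal of the Hecke relations does, and it is
  contained in \<open>J\<close>.\<close>

lemma p_relation:
  assumes "r - s \<in> klr_relations n" "x \<in> klr_carrier n" shows "p (r * x) = p (s * x)"
proof -
  interpret ideal "hecke_ideal n :: 'a klr_free set" "free_algebra (klr_gens n)"
    by (rule hecke_ideal_ideal[OF n])
  have "(r - s) * x \<in> hecke_ideal n"
    using I_r_closed[of "r - s" x] klr_relations_hecke_ideal[OF n] assms by auto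
  then show ?thesis using J_ideal by (auto simp: p_eq_iff left_diff_distrib)
qed

text \<open>The condition on \<open>i\<close> empties \<open>W i\<close> for functions that are not
  residue sequences, so that the axioms of \<open>klr_action\<close> can range over all
  \<open>i\<close>. This is why \<open>W_zero\<close> speaks of \<open>alt_seq n\<close>
  only.\<close>

definition W :: "(nat \<Rightarrow> int) \<Rightarrow> 'a klr_free set" where
  "W i = {x \<in> klr_carrier n. p x = x \<and> i \<in> residue_seqs n \<and> p (free_e i * x) = x}"

definition Y :: "nat \<Rightarrow> 'a klr_free \<Rightarrow> 'a klr_free" where "Y r x = p (free_y r * x)"

definition P :: "nat \<Rightarrow> 'a klr_free \<Rightarrow> 'a klr_free" where "P r x = p (free_psi r * x)"

lemma W_D: "x \<in> W i \<Longrightarrow> x \<in> klr_carrier n" "x \<in> W i \<Longrightarrow> p x = x" "x \<in> W i \<Longrightarrow> i \<in> residue_seqs n"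
  "x \<in> W i \<Longrightarrow> p (free_e i * x) = x"
  by (simp_all add: W_def)

text \<open>Many relations are imposed only after multiplication by e(i). On a weight vector this
  factor can be inserted and removed.\<close>

lemma p_relation_e:
  assumes "r * free_e i - s * free_e i \<in> klr_relations n" "x \<in> W i" "r \<in> klr_carrier n" "s \<in> klr_carrier n"
  shows "p (r * x) = p (s * x)"
proof -
  have "p (r * p (free_e i * x)) = p (s * p (free_e i * x))"
    using p_relation[OF assms(1) W_D(1)[OF assms(2)]] assms(3,4) by (simp add: mult.assoc)
  then show ?thesis using W_D(4)[OF assms(2)] by simp
qed

lemma act_word: "rs \<in> lists {1..<n} \<Longrightarrow> foldr P rs (p x) = p (prod_list (map free_psi rs) * x)"
  by (induction rs) (simp_all add: P_def mult.assoc)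

text \<open>In this and the following lemmas the number of \<open>UnI1\<close> selects the component
  of the left-nested union \<open>klr_relations\<close>. Unfolding \<open>diff_0_right\<close> and
  \<open>mult_minus_left\<close> turns l - r into the recorded form where r is 0 or a
  negative.\<close>

lemma rel_e1: "i \<in> residue_seqs n \<Longrightarrow> i 1 = 1 \<Longrightarrow> free_e i - 0 \<in> klr_relations n"
  unfolding klr_relations_def Let_def diff_0_right mult_minus_left
  by (rule UnI1, rule UnI1, rule UnI1, rule UnI1, rule UnI1, rule UnI1, rule UnI1, rule UnI1, rule UnI1, rule UnI1, rule UnI1, rule UnI1, rule UnI1, rule UnI2, blast)

lemma rel_ee: "i \<in> residue_seqs n \<Longrightarrow> j \<in> residue_seqs n \<Longrightarrow> free_e i * free_e j - (if i = j then free_e i else 0) \<in> klr_relations n"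
  unfolding klr_relations_def Let_def diff_0_right mult_minus_left
  by (rule UnI1, rule UnI1, rule UnI1, rule UnI1, rule UnI1, rule UnI1, rule UnI1, rule UnI1, rule UnI1, rule UnI1, rule UnI1, rule UnI1, rule UnI2, blast)

lemma rel_ye: "r \<in> {1..n} \<Longrightarrow> i \<in> residue_seqs n \<Longrightarrow> free_y r * free_e i - free_e i * free_y r \<in> klr_relations n"
  unfolding klr_relations_def Let_def diff_0_right mult_minus_left
  by (rule UnI1, rule UnI1, rule UnI1, rule UnI1, rule UnI1, rule UnI1, rule UnI1, rule UnI1, rule UnI1, rule UnI1, rule UnI2, blast)

lemma rel_psie: "r \<in> {1..<n} \<Longrightarrow> i \<in> residue_seqs n \<Longrightarrow>
    free_psi r * free_e i - free_e (swap_seq r i) * free_psi r \<in> klr_relations n"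
  unfolding klr_relations_def Let_def diff_0_right mult_minus_left
  by (rule UnI1, rule UnI1, rule UnI1, rule UnI1, rule UnI1, rule UnI1, rule UnI1, rule UnI1, rule UnI1, rule UnI2, blast)

lemma rel_ypsi: "r \<in> {1..<n} \<Longrightarrow> s \<in> {1..n} \<Longrightarrow> s \<noteq> r \<Longrightarrow> s \<noteq> r + 1 \<Longrightarrow>
    free_y s * free_psi r - free_psi r * free_y s \<in> klr_relations n"
  unfolding klr_relations_def Let_def diff_0_right mult_minus_left
  by (rule UnI1, rule UnI1, rule UnI1, rule UnI1, rule UnI1, rule UnI1, rule UnI1, rule UnI2, blast)

lemma rel_left: "r \<in> {1..<n} \<Longrightarrow> i \<in> residue_seqs n \<Longrightarrow>
    free_y r * free_psi r * free_e i -
    (free_psi r * free_y (r + 1) - (if i r = i (r + 1) then 1 else 0)) * free_e i \<in> klr_relations n"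
  unfolding klr_relations_def Let_def diff_0_right mult_minus_left
  by (rule UnI1, rule UnI1, rule UnI1, rule UnI1, rule UnI1, rule UnI1, rule UnI2, blast)

lemma rel_right: "r \<in> {1..<n} \<Longrightarrow> i \<in> residue_seqs n \<Longrightarrow>
    free_y (r + 1) * free_psi r * free_e i -
    (free_psi r * free_y r + (if i r = i (r + 1) then 1 else 0)) * free_e i \<in> klr_relations n"
  unfolding klr_relations_def Let_def diff_0_right mult_minus_left
  by (rule UnI1, rule UnI1, rule UnI1, rule UnI1, rule UnI1, rule UnI2, blast)

lemma rel_psipsi: "r \<in> {1..<n} \<Longrightarrow> s \<in> {1..<n} \<Longrightarrow> s \<noteq> r + 1 \<Longrightarrow> r \<noteq> s + 1 \<Longrightarrow>
    free_psi s * free_psi r - free_psi r * free_psi s \<in> klr_relations n"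
  unfolding klr_relations_def Let_def diff_0_right mult_minus_left
  by (rule UnI1, rule UnI1, rule UnI1, rule UnI1, rule UnI2, blast)

lemma rel_sq: "r \<in> {1..<n} \<Longrightarrow> i \<in> residue_seqs n \<Longrightarrow> i r \<noteq> i (r + 1) \<Longrightarrow>
    (free_psi r)^2 * free_e i - (- ((free_y r - free_y (r + 1))^2)) * free_e i \<in> klr_relations n"
  unfolding klr_relations_def Let_def diff_0_right mult_minus_left
  by (rule UnI1, rule UnI1, rule UnI2, blast)

lemma rel_braid: "1 \<le> r \<Longrightarrow> r + 2 \<le> n \<Longrightarrow> i \<in> residue_seqs n \<Longrightarrow> i r = i (r + 1) \<or> i (r + 1) = i (r + 2) \<Longrightarrow>
    free_psi r * free_psi (r + 1) * free_psi r * free_e i -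
    free_psi (r + 1) * free_psi r * free_psi (r + 1) * free_e i \<in> klr_relations n"
  unfolding klr_relations_def Let_def diff_0_right mult_minus_left
  by (rule UnI1, rule UnI2, blast)

lemma rel_braid_alt: "1 \<le> r \<Longrightarrow> r + 2 \<le> n \<Longrightarrow> i \<in> residue_seqs n \<Longrightarrow> i r \<noteq> i (r + 1) \<Longrightarrow> i (r + 1) \<noteq> i (r + 2) \<Longrightarrow>
    free_psi r * free_psi (r + 1) * free_psi r * free_e i -
    (free_psi (r + 1) * free_psi r * free_psi (r + 1) + free_y r - 2 * free_y (r + 1) + free_y (r + 2)) *
      free_e i \<in> klr_relations n"
  unfolding klr_relations_def Let_def diff_0_right mult_minus_left
  by (rule UnI2, blast)

lemma alt_seq_residue_seqs: "alt_seq n \<in> residue_seqs n"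
  by (auto simp: alt_seq_def residue_seqs_def)

lemma YW: assumes x: "x \<in> W i" and r: "r \<in> {1..n}" shows "Y r x \<in> W i"
proof -
  note xD = W_D[OF x]
  have "p (free_e i * Y r x) = p (free_e i * free_y r * x)"
    using r xD(3) by (simp add: Y_def mult.assoc)
  also have "\<dots> = p (free_y r * free_e i * x)" using p_relation[OF rel_ye[OF r xD(3)] xD(1)] by simp
  also have "\<dots> = p (free_y r * p (free_e i * x))" using r by (simp add: mult.assoc)
  also have "\<dots> = Y r x" by (simp add: xD(4) Y_def)
  finally show ?thesis using xD r by (simp add: W_def Y_def p_carrier)
qed

lemma PW: assumes x: "x \<in> W i" and r: "r \<in> {1..<n}" shows "P r x \<in> W (swap_seq r i)"
proof -
  note xD = W_D[OF x]
  have "p (free_e (swap_seq r i) * P r x) = p (free_e (swap_seq r i) * free_psi r * x)"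
    using r xD(3) by (simp add: P_def mult.assoc)
  also have "\<dots> = p (free_psi r * free_e i * x)" using p_relation[OF rel_psie[OF r xD(3)] xD(1)] by simp
  also have "\<dots> = p (free_psi r * p (free_e i * x))" using r by (simp add: mult.assoc)
  also have "\<dots> = P r x" by (simp add: xD(4) P_def)
  finally show ?thesis using xD r by (simp add: W_def P_def p_carrier)
qed

lemma p_e_other:
  assumes x: "x \<in> W i" and j: "j \<in> residue_seqs n" "j \<noteq> i" shows "p (free_e j * x) = 0"
proof -
  note xD = W_D[OF x]
  have "p (free_e j * x) = p (free_e j * p (free_e i * x))" by (simp add: xD(4))
  also have "\<dots> = p (free_e j * free_e i * x)" using j by (simp add: mult.assoc)
  also have "\<dots> = 0" using p_relation[OF rel_ee[OF j(1) xD(3)] xD(1)] j(2) by simp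
  finally show ?thesis .
qed

lemma klr_action: "klr_action n W Y P"
proof
  show "0 \<in> W (alt_seq n)" by (simp add: W_def alt_seq_residue_seqs)
  show "x + y \<in> W i" if "x \<in> W i" "y \<in> W i" for x y i
    using that by (simp add: W_def p_add distrib_left)
  show "Y r (x + y) = Y r x + Y r y" "P r (x + y) = P r x + P r y" for r x y
    by (simp_all add: Y_def P_def p_add distrib_left)
  fix x i assume x: "x \<in> W i"
  note xD = W_D[OF x]
  show "r \<in> {1..n} \<Longrightarrow> Y r x \<in> W i" "r \<in> {1..<n} \<Longrightarrow> P r x \<in> W (swap_seq r i)" for r
    using YW[OF x] PW[OF x] by blast+
  show "i 1 = 1 \<Longrightarrow> x = 0"
    using p_relation[OF rel_e1[OF xD(3)] xD(1)] xD(4) by simp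
  fix r
  show "Y s (P r x) = P r (Y s x)"
    if "r \<in> {1..<n}" "s \<in> {1..n}" "s \<noteq> r" "s \<noteq> r + 1" for s
    using p_relation[OF rel_ypsi[OF that] xD(1)] that by (simp add: Y_def P_def mult.assoc)
  show "P s (P r x) = P r (P s x)"
    if "r \<in> {1..<n}" "s \<in> {1..<n}" "s \<noteq> r + 1" "r \<noteq> s + 1" for s
    using p_relation[OF rel_psipsi[OF that] xD(1)] that by (simp add: P_def mult.assoc)
  show "Y r (P r x) = P r (Y (r + 1) x) - (if i r = i (r + 1) then x else 0)" if r: "r \<in> {1..<n}"
    using p_relation_e[OF rel_left[OF r xD(3)] x] r xD(2)
    by (auto simp: P_def Y_def mult.assoc left_diff_distrib p_diff)
  show "Y (r + 1) (P r x) = P r (Y r x) + (if i r = i (r + 1) then x else 0)" if r: "r \<in> {1..<n}"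
    using p_relation_e[OF rel_right[OF r xD(3)] x] r xD(2)
    by (auto simp: P_def Y_def mult.assoc distrib_right p_add)
  show "P r (P r x) = - (Y r (Y r x) - Y r (Y (r + 1) x) - Y (r + 1) (Y r x) + Y (r + 1) (Y (r + 1) x))"
    if r: "r \<in> {1..<n}" "i r \<noteq> i (r + 1)"
    using p_relation_e[OF rel_sq[OF r(1) xD(3) r(2)] x] r
    by (simp add: P_def Y_def power2_eq_square algebra_simps p_add p_diff p_minus)
  assume r: "1 \<le> r" "r + 2 \<le> n"
  show "P r (P (r + 1) (P r x)) = P (r + 1) (P r (P (r + 1) x))"
    if i: "i r = i (r + 1) \<or> i (r + 1) = i (r + 2)"
    using p_relation_e[OF rel_braid[OF r xD(3) i] x] r by (simp add: P_def mult.assoc)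
  have "p (2 * free_y (r + 1) * x) = 2 * p (free_y (r + 1) * x)"
    using p_of_nat[of 2 "free_y (r + 1) * x"] by (simp add: mult.assoc)
  then show "P r (P (r + 1) (P r x)) = P (r + 1) (P r (P (r + 1) x)) + Y r x - 2 * Y (r + 1) x + Y (r + 2) x"
    if i: "i r \<noteq> i (r + 1)" "i (r + 1) \<noteq> i (r + 2)"
    using p_relation_e[OF rel_braid_alt[OF r xD(3) i] x] r
    by (simp add: P_def Y_def mult.assoc distrib_right left_diff_distrib p_add p_diff)
qed

sublocale klr_action n W Y P
  by (rule klr_action)

end

section \<open>The Specht module\<close>

lemma free_psi_word_closed [simp]:
  "rs \<in> lists {1..<n} \<Longrightarrow> prod_list (map free_psi rs) \<in> klr_carrier n"
  by (intro prod_list_closed) auto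

definition specht_free_relations :: "nat \<Rightarrow> nat \<Rightarrow> 'a::field klr_free set" where
  "specht_free_relations a b =
     free_y ` {1..a + b} \<union>
     (\<lambda>i. free_e i - (if i = initial_residues a b then 1 else 0)) ` residue_seqs (a + b) \<union>
     free_psi ` ({1..<a + b} - {b + 1}) \<union>
     (if a = 1 then {} else {prod_list (map free_psi [1..<b + 2])})"

context
  fixes a b :: nat
  assumes a: "0 < a"
begin

lemma n_pos: "0 < a + b" using a by simp

lemma specht_free_relations_carrier: "specht_free_relations a b \<subseteq> klr_carrier (a + b)"
proof -
  have "[1..<b + 2] \<in> lists {1..<a + b}" if "a \<noteq> 1" using that a by auto
  then show ?thesis
    unfolding specht_free_relations_def using a
    by (intro Un_least) (auto simp del: upt_Suc upt.simps)
qed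

lemma specht_relations_eq: "specht_relations a b = hecke_class (a + b) ` specht_free_relations a b"
proof -
  have word: "foldr (\<lambda>r h. hecke_psi (a + b) r \<otimes>\<^bsub>hecke_algebra (a + b)\<^esub> h) [1..<b + 2] \<one>\<^bsub>hecke_algebra (a + b)\<^esub>
      = hecke_class (a + b) (prod_list (map free_psi [1..<b + 2]))" if "a \<noteq> 1"
    using that a by (subst hecke_class_prod_list) (auto simp: n_pos foldr_map comp_def hecke_psi_def)
  have 1: "hecke_class (a + b) ` (if a = 1 then {} else {prod_list (map free_psi [1..<b + 2])}) = (if a = 1 then {}
      else {foldr (\<lambda>r h. hecke_psi (a + b) r \<otimes>\<^bsub>hecke_algebra (a + b)\<^esub> h) [1..<b + 2] \<one>\<^bsub>hecke_algebra (a + b)\<^esub>})"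
  proof (cases "a = 1")
    case False
    then show ?thesis by (simp only: word[OF False] if_False image_insert image_empty)
  qed simp
  have "hecke_class (a + b) (free_e i - (if i = j then 1 else 0)) =
      hecke_e (a + b) i \<ominus>\<^bsub>hecke_algebra (a + b)\<^esub> (if i = j then \<one>\<^bsub>hecke_algebra (a + b)\<^esub> else \<zero>\<^bsub>hecke_algebra (a + b)\<^esub>)"
    if "i \<in> residue_seqs (a + b)" for i j
    using that n_pos hecke_class_simps(4)[OF n_pos, of "free_e i" 1] hecke_class_simps(4)[OF n_pos, of "free_e i" 0]
    by (auto simp: hecke_e_def hecke_class_0_1)
  then have 2: "hecke_class (a + b) ` (\<lambda>i. free_e i - (if i = j then 1 else 0)) ` residue_seqs (a + b) =
      {hecke_e (a + b) i \<ominus>\<^bsub>hecke_algebra (a + b)\<^esub> (if i = j then \<one>\<^bsub>hecke_algebra (a + b)\<^esub> else \<zero>\<^bsub>hecke_algebra (a + b)\<^esub>) |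
        i. i \<in> residue_seqs (a + b)}" for j
    unfolding Setcompr_eq_image image_image by (intro image_cong refl)
  have 3: "hecke_class (a + b) ` free_y ` {1..a + b} = {hecke_y (a + b) k | k. k \<in> {1..a + b}}"
    by (auto simp: hecke_y_def)
  have 4: "hecke_class (a + b) ` free_psi ` ({1..<a + b} - {b + 1}) = {hecke_psi (a + b) j | j. j \<in> {1..<a + b} \<and> j \<noteq> b + 1}"
    by (auto simp: hecke_psi_def)
  show ?thesis
    unfolding specht_relations_def specht_free_relations_def Let_def image_Un 1 2 3 4 ..
qed

lemma specht_left_ideal: "left_ideal (hecke_algebra (a + b)) (specht_ideal a b)"
  and specht_relations_ideal: "specht_relations a b \<subseteq> specht_ideal a b"
proof -
  have "specht_relations a b \<subseteq> carrier (hecke_algebra (a + b))"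
    unfolding specht_relations_eq hecke_class_surj[OF n_pos]
    using specht_free_relations_carrier by (rule image_mono)
  from left_ideal_left_ideal_gen[OF ring_hecke_algebra[OF n_pos] this]
    left_ideal_gen_superset[OF ring_hecke_algebra[OF n_pos] this]
  show "left_ideal (hecke_algebra (a + b)) (specht_ideal a b)"
    and "specht_relations a b \<subseteq> specht_ideal a b" by (simp_all add: specht_ideal_def)
qed

lemma specht_kernel_carrier: "x \<in> specht_kernel a b \<Longrightarrow> x \<in> klr_carrier (a + b)"
  by (simp add: specht_kernel_def)

lemma specht_kernel_add: "x \<in> specht_kernel a b \<Longrightarrow> y \<in> specht_kernel a b \<Longrightarrow> x + y \<in> specht_kernel a b"
  using specht_left_ideal n_pos
  by (auto simp: specht_kernel_def hecke_class_simps[OF n_pos] left_ideal_def intro!: additive_subgroup.a_closed)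

lemma specht_kernel_mult:
  "x \<in> specht_kernel a b \<Longrightarrow> r \<in> klr_carrier (a + b) \<Longrightarrow> r * x \<in> specht_kernel a b"
  using specht_left_ideal n_pos by (auto simp: specht_kernel_def hecke_class_simps[OF n_pos] left_ideal_def)

lemma hecke_ideal_specht_kernel: "hecke_ideal (a + b) \<subseteq> specht_kernel a b"
proof
  fix x :: "'a::field klr_free" assume x: "x \<in> hecke_ideal (a + b)"
  interpret ideal "hecke_ideal (a + b) :: 'a klr_free set" "free_algebra (klr_gens (a + b))"
    by (rule hecke_ideal_ideal[OF n_pos])
  have xC: "x \<in> klr_carrier (a + b)" using a_Hcarr[OF x] .
  then have "hecke_class (a + b) x = hecke_class (a + b) 0" using x n_pos by (simp add: hecke_class_eq_iff)
  moreover have "\<zero>\<^bsub>hecke_algebra (a + b)\<^esub> \<in> specht_ideal a b"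
    using specht_left_ideal additive_subgroup.zero_closed by (auto simp: left_ideal_def)
  ultimately show "x \<in> specht_kernel a b"
    using xC n_pos by (simp add: specht_kernel_def hecke_class_0_1)
qed

lemma specht_kernel_0: "0 \<in> specht_kernel a b"
  using hecke_ideal_specht_kernel additive_subgroup.zero_closed[OF ideal.axioms(1)[OF hecke_ideal_ideal[OF n_pos]]]
  by auto

lemma specht_free_relations_kernel: "specht_free_relations a b \<subseteq> specht_kernel a b"
  using specht_relations_ideal specht_free_relations_carrier
  by (auto simp: specht_kernel_def specht_relations_eq)

text \<open>The image of \<open>K\<close> in the Hecke algebra is a left ideal containing the Specht
  relations, hence contains \<open>specht_ideal\<close>. So an element of the kernel differs from an
  element of \<open>K\<close> by one of \<open>hecke_ideal\<close>, which lies in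
  \<open>K\<close>.\<close>

lemma specht_kernel_minimal:
  fixes K :: "'a::field klr_free set"
  assumes K: "K \<subseteq> klr_carrier (a + b)" "hecke_ideal (a + b) \<subseteq> K" "specht_free_relations a b \<subseteq> K"
    and add: "\<And>x y. x \<in> K \<Longrightarrow> y \<in> K \<Longrightarrow> x + y \<in> K"
    and mult: "\<And>r x. r \<in> klr_carrier (a + b) \<Longrightarrow> x \<in> K \<Longrightarrow> r * x \<in> K"
  shows "specht_kernel a b \<subseteq> K"
proof
  interpret I: ideal "hecke_ideal (a + b) :: 'a klr_free set" "free_algebra (klr_gens (a + b))"
    by (rule hecke_ideal_ideal[OF n_pos])
  interpret h: ring_hom_ring "free_algebra (klr_gens (a + b))" "hecke_algebra (a + b)" "hecke_class (a + b) :: 'a klr_free \<Rightarrow> _"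
    by (rule ring_hom_ringI2[OF ring_free_algebra ring_hecke_algebra hecke_class_hom]) (rule n_pos)+
  have zero: "0 \<in> K" using additive_subgroup.zero_closed[OF I.is_additive_subgroup] K(2) by auto
  have neg: "- x \<in> K" if "x \<in> K" for x
    using mult[of "- 1" x] that by simp
  have "left_ideal (hecke_algebra (a + b)) (hecke_class (a + b) ` K)"
    unfolding left_ideal_def
  proof (intro conjI ballI)
    show "additive_subgroup (hecke_class (a + b) ` K) (hecke_algebra (a + b))"
    proof (rule additive_subgroup.intro, rule subgroup.intro, goal_cases)
      case 1
      then show ?case using K(1) by auto
    next
      case (2 x y)
      then obtain p q where "p \<in> K" "q \<in> K" "x = hecke_class (a + b) p" "y = hecke_class (a + b) q" by auto
      then have "x \<oplus>\<^bsub>hecke_algebra (a + b)\<^esub> y = hecke_class (a + b) (p + q)"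
        using K(1) n_pos hecke_class_simps(3)[OF n_pos, of p q] by auto
      then show ?case using add \<open>p \<in> K\<close> \<open>q \<in> K\<close> by simp
    next
      case 3
      from zero have "hecke_class (a + b) 0 \<in> hecke_class (a + b) ` K" by (rule imageI)
      then show ?case using h.hom_zero by simp
    next
      case (4 x)
      then obtain p where p: "p \<in> K" "x = hecke_class (a + b) p" by auto
      then have "hecke_class (a + b) (- p) = \<ominus>\<^bsub>hecke_algebra (a + b)\<^esub> x"
        using h.hom_a_inv[of p] K(1) by auto
      moreover have "hecke_class (a + b) (- p) \<in> hecke_class (a + b) ` K" using neg[OF p(1)] by (rule imageI)
      ultimately show ?case by (simp add: a_inv_def)
    qed
    fix r x assume "r \<in> carrier (hecke_algebra (a + b) :: 'a hecke ring)" "x \<in> hecke_class (a + b) ` K"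
    then obtain p q where "p \<in> klr_carrier (a + b)" "q \<in> K"
      "r = hecke_class (a + b) p" "x = hecke_class (a + b) q" unfolding hecke_class_surj[OF n_pos] by auto
    moreover from this have "r \<otimes>\<^bsub>hecke_algebra (a + b)\<^esub> x = hecke_class (a + b) (p * q)"
      using K(1) n_pos hecke_class_simps(2)[OF n_pos, of p q] by auto
    ultimately show "r \<otimes>\<^bsub>hecke_algebra (a + b)\<^esub> x \<in> hecke_class (a + b) ` K" using mult by blast
  qed
  then have sub: "specht_ideal a b \<subseteq> hecke_class (a + b) ` K"
    unfolding specht_ideal_def using K(3)
    by (intro left_ideal_gen_minimal) (auto simp: specht_relations_eq)
  fix x :: "'a klr_free" assume "x \<in> specht_kernel a b"
  then have x: "x \<in> klr_carrier (a + b)" "hecke_class (a + b) x \<in> specht_ideal a b"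
    by (auto simp: specht_kernel_def)
  then obtain k where k: "k \<in> K" "hecke_class (a + b) x = hecke_class (a + b) k" using sub by auto
  then have "x - k \<in> hecke_ideal (a + b)" using hecke_class_eq_iff[OF n_pos x(1), of k] K(1) by auto
  then have "(x - k) + k \<in> K" using add k K(2) by blast
  then show "x \<in> K" by simp
qed

lemma specht_carrier: "carrier (specht a b) = specht_class a b ` klr_carrier (a + b)"
  unfolding specht_def left_quotient_carrier[OF ring_hecke_algebra[OF n_pos] specht_left_ideal]
    hecke_class_surj[OF n_pos]
  by (simp add: specht_class_def image_image)

lemma specht_abelian_group: "abelian_group (specht a b)"
  unfolding specht_def by (rule left_quotient_abelian_group[OF ring_hecke_algebra[OF n_pos] specht_left_ideal])

lemma specht_class_add:
  assumes "p \<in> klr_carrier (a + b)" "q \<in> klr_carrier (a + b)"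
  shows "specht_class a b (p + q) = specht_class a b p \<oplus>\<^bsub>specht a b\<^esub> specht_class a b q"
  using assms
  by (simp add: specht_class_def specht_def hecke_class_simps[OF n_pos]
    left_quotient_add[OF ring_hecke_algebra[OF n_pos] specht_left_ideal])

lemma specht_class_mult:
  assumes "p \<in> klr_carrier (a + b)" "q \<in> klr_carrier (a + b)"
  shows "specht_class a b (p * q) = hecke_class (a + b) p \<odot>\<^bsub>specht a b\<^esub> specht_class a b q"
  using assms
  by (simp add: specht_class_def specht_def hecke_class_simps[OF n_pos]
    left_quotient_smult[OF ring_hecke_algebra[OF n_pos] specht_left_ideal])

lemma specht_class_eq_iff:
  assumes "p \<in> klr_carrier (a + b)" "q \<in> klr_carrier (a + b)"
  shows "specht_class a b p = specht_class a b q \<longleftrightarrow> p - q \<in> specht_kernel a b"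
  using assms
  by (simp add: specht_class_def specht_kernel_def hecke_class_simps[OF n_pos]
    left_quotient_eq_iff[OF ring_hecke_algebra[OF n_pos] specht_left_ideal])

lemma specht_class_carrier [simp]:
  "p \<in> klr_carrier (a + b) \<Longrightarrow> specht_class a b p \<in> carrier (specht a b)"
  by (simp add: specht_carrier)

lemma specht_class_0: "specht_class a b 0 = \<zero>\<^bsub>specht a b\<^esub>"
proof -
  interpret abelian_group "specht a b" by (rule specht_abelian_group)
  have "specht_class a b 0 \<oplus>\<^bsub>specht a b\<^esub> specht_class a b 0 = specht_class a b 0"
    using specht_class_add[of 0 0] by simp
  then show ?thesis using add.l_cancel_one'[of "specht_class a b 0" "specht_class a b 0"] by simp
qed

lemma specht_class_sum:
  assumes "finite A" "\<And>x. x \<in> A \<Longrightarrow> f x \<in> klr_carrier (a + b)"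
  shows "specht_class a b (sum f A) = finsum (specht a b) (\<lambda>x. specht_class a b (f x)) A"
proof -
  interpret abelian_group "specht a b" by (rule specht_abelian_group)
  show ?thesis using assms
  proof (induction A rule: finite_induct)
    case empty
    then show ?case by (simp add: specht_class_0)
  next
    case (insert x A)
    then show ?case by (subst finsum_insert) (auto simp: specht_class_add)
  qed
qed

lemma specht_z_eq: "specht_z a b = specht_class a b 1"
  by (simp add: specht_z_def specht_class_def hecke_class_0_1[OF n_pos])

lemma specht_word:
  "rs \<in> lists {1..<a + b} \<Longrightarrow> foldr (\<lambda>r v. hecke_psi (a + b) r \<odot>\<^bsub>specht a b\<^esub> v) rs (specht_z a b)
    = specht_class a b (prod_list (map free_psi rs))"
proof (induction rs)
  case (Cons r rs)
  then have "prod_list (map free_psi rs) \<in> klr_carrier (a + b)" "r \<in> {1..<a + b}"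
    by simp_all
  with Cons show ?case by (simp add: specht_class_mult hecke_psi_def)
qed (simp add: specht_z_eq)

text \<open>The map is right multiplication by \<open>U\<close> on representatives. It is well
  defined because the elements that \<open>U\<close> multiplies into the kernel form a left ideal,
  which contains the Specht relations by hypothesis and \<open>hecke_ideal\<close> because this is
  two-sided; by minimality it contains the kernel.\<close>

lemma specht_hom_exists:
  assumes U: "U \<in> klr_carrier (a + b)"
    and rel: "\<And>x. x \<in> specht_free_relations a b \<Longrightarrow> x * U \<in> specht_kernel a b"
  shows "\<exists>f \<in> left_module_hom (hecke_algebra (a + b)) (specht a b) (specht a b).
    f (specht_z a b) = specht_class a b U"
proof -
  let ?C = "klr_carrier (a + b)" and ?J = "specht_kernel a b"
  interpret I: ideal "hecke_ideal (a + b)" "free_algebra (klr_gens (a + b))"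
    by (rule hecke_ideal_ideal[OF n_pos])
  have "?J \<subseteq> {p \<in> ?C. p * U \<in> ?J}"
  proof (rule specht_kernel_minimal)
    show "hecke_ideal (a + b) \<subseteq> {p \<in> ?C. p * U \<in> ?J}"
      using I.a_subset I.I_r_closed[OF _ U] hecke_ideal_specht_kernel by auto
  qed (use specht_free_relations_carrier rel specht_kernel_add specht_kernel_mult U
      in \<open>auto simp: distrib_right mult.assoc\<close>)
  then have JU: "p * U \<in> ?J" if "p \<in> ?J" for p using that by blast
  define f where "f X = specht_class a b ((SOME p. p \<in> ?C \<and> specht_class a b p = X) * U)" for X
  have f: "f (specht_class a b p) = specht_class a b (p * U)" if p: "p \<in> ?C" for p
  proof -
    define q where "q = (SOME q. q \<in> ?C \<and> specht_class a b q = specht_class a b p)"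
    have q: "q \<in> ?C" "specht_class a b q = specht_class a b p"
      unfolding q_def using someI[of "\<lambda>q. q \<in> ?C \<and> specht_class a b q = specht_class a b p" p] p by auto
    then have "(q - p) * U \<in> ?J" using JU[of "q - p"] specht_class_eq_iff[of q p] p by simp
    then show ?thesis
      using q p U by (simp add: f_def q_def[symmetric] specht_class_eq_iff left_diff_distrib)
  qed
  have "f \<in> left_module_hom (hecke_algebra (a + b)) (specht a b) (specht a b)"
    unfolding left_module_hom_def specht_carrier hecke_class_surj[OF n_pos]
    using U by (auto simp: f specht_class_add[symmetric] specht_class_mult[symmetric] distrib_right mult.assoc)
  moreover have "f (specht_z a b) = specht_class a b U" by (simp add: specht_z_eq f)
  ultimately show ?thesis by blast
qed

end

section \<open>Assembly of the endomorphism\<close>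

theorem proposition6p2:
  fixes a b n :: nat
  assumes "odd a" and "even b" and "b > 0" and "n = a + b"
  shows "\<exists>f :: 'a::field specht \<Rightarrow> 'a specht.
    f \<in> left_module_hom (hecke_algebra n) (specht a b) (specht a b) \<and>
    f (specht_z a b) =
      finsum (specht a b)
        (\<lambda>(i, j). hecke_scalar n (of_nat ((i - 1) div 2) * of_nat ((n + 2 - j) div 2))
           \<odot>\<^bsub>specht a b\<^esub> specht_v a b (T_tableau a b i j))
        {(i, j). 3 \<le> i \<and> i \<le> b + 1 \<and> b + 3 \<le> j \<and> j \<le> n \<and> odd i \<and> odd j}"
proof -
  have a: "0 < a" using assms(1) by (simp add: odd_pos)
  define C where "C = (klr_carrier n :: 'a klr_free set)"
  define J where "J = (specht_kernel a b :: 'a klr_free set)"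
  let ?I = "{(i, j). 3 \<le> i \<and> i \<le> b + 1 \<and> b + 3 \<le> j \<and> j \<le> n \<and> odd i \<and> odd j}"
  interpret S: abelian_group "specht a b :: ('a hecke, 'a specht) module"
    by (rule specht_abelian_group[OF a])
  show ?thesis
  proof (cases "a = 1")
    \<comment> \<open>Now n = b + 1, so there is no admissible j and the sum is empty; f is the zero
      map. The domino argument needs at least one arm domino.\<close>
    case True
    then have I: "?I = {}" using assms by auto
    have "\<exists>f \<in> left_module_hom (hecke_algebra n) (specht a b) (specht a b).
        f (specht_z a b) = specht_class a b (0 :: 'a klr_free)"
      unfolding assms(4) by (rule specht_hom_exists[OF a]) (simp_all add: specht_kernel_0[OF a])
    then show ?thesis unfolding I S.finsum_empty specht_class_0[OF a] by blast
  next
    case False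
    obtain m where m: "b = 2 * m" using assms(2) by (elim evenE)
    obtain k where k: "a = 2 * k + 1" using assms(1) by (elim oddE)
    define N where "N = m + k"
    have nN: "n = 2 * N + 1" and mN: "0 < m" "m < N" using m k assms False by (auto simp: N_def)
    have J0: "0 \<in> J" unfolding J_def by (rule specht_kernel_0[OF a])
    have J_add: "x + y \<in> J" if "x \<in> J" "y \<in> J" for x y
      using that unfolding J_def by (rule specht_kernel_add[OF a])
    have J_mult: "r * x \<in> J" if "x \<in> J" "r \<in> klr_carrier n" for r x
      using that unfolding J_def assms(4) by (rule specht_kernel_mult[OF a])
    obtain p :: "'a klr_free \<Rightarrow> 'a klr_free" where p:
      "\<And>x y. p (x + y) = p x + p y" "\<And>x. x - p x \<in> J" "\<And>x. x \<in> J \<Longrightarrow> p x = 0"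
      by (rule exists_additive_projection[of J]) (auto simp: J0 J_add J_mult)
    interpret left_ideal_projection n J p
    proof
      show "0 < n" using a assms(4) by simp
      show "J \<subseteq> klr_carrier n"
        unfolding J_def assms(4) using specht_kernel_carrier[OF a] by blast
      show "hecke_ideal n \<subseteq> J"
        unfolding J_def assms(4) by (rule hecke_ideal_specht_kernel[OF a])
    qed (use J_add J_mult p in auto)
    define z where "z = p 1"
    define word where "word rs = (prod_list (map free_psi rs) :: 'a klr_free)" for rs
    have word_C: "word rs \<in> C" if "rs \<in> lists {1..<n}" for rs
      using that by (simp add: word_def C_def)
    have act: "act rs z = p (word rs)" if "rs \<in> lists {1..<n}" for rs
      using act_word[OF that, of 1] by (simp add: z_def word_def)
    have rel: "p x = 0" if "x \<in> specht_free_relations a b" for x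
      using that specht_free_relations_kernel[OF a] p(3) by (auto simp: J_def)
    have res: "initial_residues a b = alt_seq n"
      using initial_residues_eq[OF a assms(2)] assms(4) by simp
    have rels: "specht_free_relations a b = free_y ` {1..n} \<union>
        (\<lambda>i. free_e i - (if i = alt_seq n then 1 else 0)) ` residue_seqs n \<union>
        free_psi ` ({1..<n} - {b + 1}) \<union> {word [1..<b + 2]}"
      using False by (simp only: specht_free_relations_def assms(4)[symmetric] res word_def if_False)
    have Yz: "Y r z = 0" if "r \<in> {1..n}" for r
      using rel[of "free_y r"] that by (simp add: Y_def z_def specht_free_relations_def assms(4))
    have Pz: "P r z = 0" if "r \<in> {1..<n}" "r \<noteq> b + 1" for r
      using rel[of "free_psi r"] that by (simp add: P_def z_def specht_free_relations_def assms(4))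
    have "(free_e (alt_seq n) - 1 :: 'a klr_free) \<in> specht_free_relations a b"
      unfolding specht_free_relations_def res using alt_seq_residue_seqs unfolding assms(4) by auto
    then have "p (free_e (alt_seq n) - 1) = 0" by (rule rel)
    then have "p (free_e (alt_seq n)) = p 1" by (simp add: p_diff)
    then have zW: "z \<in> W (alt_seq n)"
      using alt_seq_residue_seqs by (simp add: W_def z_def p_carrier)
    have "P r z = 0" if "r \<in> {1..<n}" "even r" for r
      using Pz[of r] that assms(2) by (cases "r = b + 1") auto
    then have good: "z \<in> good"
      using zW Yz by (auto simp: good_def)
    have Pz': "\<forall>k. 0 < k \<and> k < N \<and> k \<noteq> m \<longrightarrow> P (2 * k + 1) z = 0"
      using Pz m nN by auto
    note hyps = nN mN good Pz'
    define X where "X = {..m - 1} \<times> {..N - m - 1}"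
    define c where "c = (\<lambda>(s, t). (m - s) * (N - m - t))"
    define w where "w = (\<lambda>(s, t). left_word m s @ right_word m (Suc t))"
    \<comment> \<open>The entries of the first column of T_{i,j}, including 1, for i = 2(m - s) + 1
      and j = 2(m + t + 1) + 1.\<close>
    define A where "A = (\<lambda>(s, t). {1..2 * m + 1} - {2 * (m - s), 2 * (m - s) + 1}
      \<union> {2 * (m + Suc t), 2 * (m + Suc t) + 1})"
    \<comment> \<open>A lift of f(z) to the free algebra, formed with the domino words in place of
      the selected reduced words.\<close>
    define U where "U = (\<Sum>x\<in>X. of_nat (c x) * word (w x))"
    have raising: "raising n {1..b + 1} (w x) (A x)" if "x \<in> X" for x
      using that left_word_raising[of m "snd x" N "fst x"] mN
      by (auto simp: X_def w_def A_def m nN split: prod.splits)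
    then have w_lists: "w x \<in> lists {1..<n}" if "x \<in> X" for x using that raising_lists by blast
    have U_C: "U \<in> C"
      unfolding U_def C_def by (rule free_algebra_sum) (use word_C w_lists in \<open>simp add: C_def\<close>)
    have pU: "p U = endo_vec N m z"
    proof -
      have "p U = (\<Sum>x\<in>X. of_nat (c x) * act (w x) z)"
        unfolding U_def p_sum by (rule sum.cong) (simp_all only: p_of_nat act[OF w_lists])
      also have "\<dots> = endo_vec N m z"
        unfolding endo_vec_def[OF hyps] X_def c_def w_def sum.cartesian_product by (rule sum.cong) auto
      finally show ?thesis .
    qed
    have "x * U \<in> J" if x: "x \<in> specht_free_relations a b" for x :: "'a klr_free"
    proof -
      have xC: "x \<in> C" using x specht_free_relations_carrier[OF a] by (auto simp: C_def assms(4))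
      \<comment> \<open>Replacing \<open>U\<close> by \<open>p U\<close>, which is
        \<open>endo_vec N m z\<close>, reduces each relation to a fact about the action on this
        vector.\<close>
      then have eq: "p (x * U) = p (x * p U)" by (simp add: C_def)
      consider r where "r \<in> {1..n}" "x = free_y r"
        | i where "i \<in> residue_seqs n" "x = free_e i - (if i = alt_seq n then 1 else 0)"
        | r where "r \<in> {1..<n}" "r \<noteq> b + 1" "x = free_psi r"
        | "x = word [1..<b + 2]"
        using x unfolding rels by blast
      then have "p (x * p U) = 0"
      proof cases
        case (1 r)
        then show ?thesis using endo_vec_good[OF hyps] by (simp add: pU good_def Y_def[symmetric])
      next
        case (2 i)
        have uW: "endo_vec N m z \<in> W (alt_seq n)" by (rule endo_vec_W[OF hyps])
        show ?thesis using 2 W_D(2,4)[OF uW] p_e_other[OF uW 2(1)]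
          by (simp add: pU left_diff_distrib p_diff)
      next
        case (3 r)
        then show ?thesis using P_endo_vec[OF hyps, of r] by (simp add: pU m P_def[symmetric])
      next
        case 4
        have "[1..<2 * m + 2] \<in> lists {1..<n}" using mN nN by auto
        then show ?thesis
          using act_word[of "[1..<2 * m + 2]" U] cycle_endo_vec[OF hyps] 4 eq by (simp only: pU word_def m)
      qed
      then have "p (x * U) = 0" by (simp only: eq)
      then show ?thesis by (simp only: p_eq_0_iff)
    qed
    then have "\<exists>f \<in> left_module_hom (hecke_algebra n) (specht a b) (specht a b).
        f (specht_z a b) = specht_class a b U"
      unfolding assms(4) by (intro specht_hom_exists[OF a]) (use U_C in \<open>simp_all add: C_def J_def assms(4)\<close>)
    moreover have "specht_class a b U = finsum (specht a b)
        (\<lambda>(i, j). hecke_scalar n (of_nat ((i - 1) div 2) * of_nat ((n + 2 - j) div 2))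
           \<odot>\<^bsub>specht a b\<^esub> specht_v a b (T_tableau a b i j)) ?I"
    proof -
      \<comment> \<open>With p = m - s and q = m + t + 1 this is (2p + 1, 2q + 1), so (i - 1)/2 = p
        and (n + 2 - j)/2 = N + 1 - q.\<close>
      define h where "h = (\<lambda>(s, t). (2 * (m - s) + 1, 2 * (m + Suc t) + 1))"
      have inj: "inj_on h X" using mN by (auto simp: inj_on_def h_def X_def)
      have img: "h ` X = ?I"
      proof (intro equalityI subsetI)
        fix y assume "y \<in> h ` X"
        then show "y \<in> ?I" using mN by (auto simp: h_def X_def m nN)
      next
        fix y assume y: "y \<in> ?I"
        obtain i j where ij: "y = (i, j)" by (cases y)
        obtain i' j' where ij': "i = 2 * i' + 1" "j = 2 * j' + 1" using y ij by (auto elim!: oddE)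
        have "y = h (m - i', j' - m - 1)" "(m - i', j' - m - 1) \<in> X"
          using y ij ij' mN by (auto simp: h_def X_def m nN)
        then show "y \<in> h ` X" by blast
      qed
      have term_eq: "(case h x of (i, j) \<Rightarrow>
          hecke_scalar n (of_nat ((i - 1) div 2) * of_nat ((n + 2 - j) div 2))
           \<odot>\<^bsub>specht a b\<^esub> specht_v a b (T_tableau a b i j))
        = specht_class a b (of_nat (c x) * word (w x))" if x: "x \<in> X" for x
      proof -
        obtain s t where st: "x = (s, t)" by (cases x)
        have bounds: "s < m" "m + t < N" using x mN by (auto simp: st X_def)
        define i where "i = 2 * (m - s) + 1"
        define j where "j = 2 * (m + Suc t) + 1"
        have hx: "h x = (i, j)" by (simp add: h_def st i_def j_def)
        define rs where "rs = (SOME rs. reduced_expression (a + b) (tableau_perm a b (T_tableau a b i j)) rs)"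
        have A1: "1 \<in> A x" using bounds by (auto simp: A_def st)
        have "A x - {1} = ({2..b + 1} - {i - 1, i}) \<union> {j - 1, j}"
          using bounds by (auto simp: A_def st i_def j_def m)
        then have rs: "raising n {1..b + 1} rs (A x)"
          using T_tableau_reduced[OF _ a A1, of b "w x" i j] raising[OF x] unfolding rs_def assms(4) by blast
        have A_sub: "A x \<subseteq> {1..n}" "card (A x) = b + 1"
          using raising_subset_card[OF raising[OF x]] a assms(4) by auto
        \<comment> \<open>The selected reduced word and the domino word raise
          \<open>{1..b + 1}\<close> to the same set, so they give the same vector v_T.\<close>
        have "act rs z = act (w x) z"
          using raising_unique[OF zW rs raising[OF x] A_sub] .
        then have "p (word rs) = p (word (w x))" using act raising_lists[OF rs] w_lists[OF x] by simp
        then have "specht_class a b (word rs) = specht_class a b (word (w x))"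
          using word_C[OF raising_lists[OF rs]] word_C[OF w_lists[OF x]]
          by (simp add: specht_class_eq_iff[OF a] p_eq_iff J_def C_def assms(4))
        moreover have "specht_v a b (T_tableau a b i j) = specht_class a b (word rs)"
          using specht_word[OF a, of rs] raising_lists[OF rs]
          by (simp add: specht_v_def rs_def[symmetric] word_def assms(4))
        moreover have "hecke_scalar n (of_nat ((i - 1) div 2) * of_nat ((n + 2 - j) div 2))
            = hecke_class n (of_nat (c x) :: 'a klr_free)"
        proof -
          have "(i - 1) div 2 = m - s" "(n + 2 - j) div 2 = N - m - t"
            using bounds by (auto simp: i_def j_def nN)
          then show ?thesis
            by (simp only: hecke_scalar_def c_def st prod.case of_nat_eq_single of_nat_mult)
        qed
        ultimately show ?thesis
          using specht_class_mult[OF a, of "of_nat (c x)" b "word (w x)"] word_C[OF w_lists[OF x]]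
          by (simp add: hx C_def assms(4))
      qed
      let ?t = "\<lambda>(i, j). hecke_scalar n (of_nat ((i - 1) div 2) * of_nat ((n + 2 - j) div 2))
           \<odot>\<^bsub>specht a b\<^esub> (specht_v a b (T_tableau a b i j) :: 'a specht)"
      have summand_C: "of_nat (c x) * word (w x) \<in> klr_carrier (a + b)" if "x \<in> X" for x
        using word_C[OF w_lists[OF that]] by (simp add: C_def assms(4))
      have t_carrier: "?t (h x) \<in> carrier (specht a b)" if "x \<in> X" for x
        unfolding term_eq[OF that] by (rule specht_class_carrier[OF a summand_C[OF that]])
      have "specht_class a b U = finsum (specht a b) (\<lambda>x. specht_class a b (of_nat (c x) * word (w x))) X"
        unfolding U_def by (rule specht_class_sum[OF a _ summand_C]) (auto simp: X_def)
      also have "\<dots> = finsum (specht a b) (\<lambda>x. ?t (h x)) X"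
        by (rule S.finsum_cong'[OF refl]) (use t_carrier in blast, rule term_eq[symmetric])
      also have "\<dots> = finsum (specht a b) ?t (h ` X)"
        by (rule S.finsum_reindex[symmetric, OF _ inj]) (use t_carrier in blast)
      finally show ?thesis unfolding img .
    qed
    ultimately show ?thesis by auto
  qed
qed

end
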